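(* Let $n,N\geq 2$, let $\Omega\subseteq\mathbb{R}^n$ be a bounded open set, and let $F,G:\Omega\times\mathbb{R}^{Nn^2}_s\to\mathbb{R}^N$ be Carathéodory maps. Suppose the map $u\mapsto F(\cdot,D^2u)$ is a bijection from $(H^2\cap H^1_0)(\Omega)^N$ onto $L^2(\Omega)^N$, that $G(\cdot,\mathbf{0})\in L^2(\Omega)^N$, and that \[ \operatorname*{ess\,sup}_{x\in\Omega}\sup_{\mathbf{X}\neq\mathbf{Y}}\frac{\big|\big(F(x,\mathbf{Y})-F(x,\mathbf{X})\big)-\big(G(x,\mathbf{Y})-G(x,\mathbf{X})\big)\big|}{|\mathbf{Y}-\mathbf{X}|}<\nu(F), \] where \[ \nu(F):=\inf_{v\neq w}\frac{\|F(\cdot,D^2w)-F(\cdot,D^2v)\|_{L^2(\Omega)}}{\|D^2w-D^2v\|_{L^2(\Omega)}}>0, \] the infimum being over $v,w\in(H^2\cap H^1_0)(\Omega)^N$. Then for every $g\in L^2(\Omega)^N$ the problem $G(\cdot,D^2u)=g$ in $\Omega$, $u=0$ on $\partial\Omega$, has a unique solution $u\in(H^2\cap H^1_0)(\Omega)^N$.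
   Context: $\mathbb{R}^{Nn^2}_s=\{\mathbf{X}=(\mathbf{X}_{\alpha ij})\in\mathbb{R}^{N\times n\times n}:\mathbf{X}_{\alpha ij}=\mathbf{X}_{\alpha ji}\}$ with the Euclidean norm; $D^2u$ denotes the Hessian tensor of $u:\Omega\to\mathbb{R}^N$. A map $F:\Omega\times\mathbb{R}^{Nn^2}_s\to\mathbb{R}^N$ is Carathéodory if $x\mapsto F(x,\mathbf{X})$ is measurable for each $\mathbf{X}$ and $\mathbf{X}\mapsto F(x,\mathbf{X})$ is continuous for a.e. $x$. *)

theory Defs
  imports "HOL-Analysis.Analysis" "HOL-Probability.Essential_Supremum"
begin

definition pd :: "'n::finite \<Rightarrow> (real^'n \<Rightarrow> real) \<Rightarrow> real^'n \<Rightarrow> real" where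
  "pd i \<phi> x = frechet_derivative \<phi> (at x) (axis i 1)"

fun Ck :: "nat \<Rightarrow> (real^'n::finite \<Rightarrow> real) \<Rightarrow> bool" where
  "Ck 0 \<phi> = continuous_on UNIV \<phi>"
| "Ck (Suc k) \<phi> = (continuous_on UNIV \<phi> \<and> \<phi> differentiable_on UNIV \<and> (\<forall>i. Ck k (pd i \<phi>)))"

definition smooth_fun :: "(real^'n::finite \<Rightarrow> real) \<Rightarrow> bool" where
  "smooth_fun \<phi> \<longleftrightarrow> (\<forall>k. Ck k \<phi>)"

definition test_fun :: "(real^'n::finite) set \<Rightarrow> (real^'n \<Rightarrow> real) \<Rightarrow> bool" where
  "test_fun \<Omega> \<phi> \<longleftrightarrow> smooth_fun \<phi> \<and> compact (closure {x. \<phi> x \<noteq> 0})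
      \<and> closure {x. \<phi> x \<noteq> 0} \<subseteq> \<Omega>"

definition loc_int :: "(real^'n::finite) set \<Rightarrow> (real^'n \<Rightarrow> real) \<Rightarrow> bool" where
  "loc_int \<Omega> f \<longleftrightarrow> (\<forall>K. compact K \<and> K \<subseteq> \<Omega> \<longrightarrow> integrable (lebesgue_on K) f)"

definition weak_partial :: "(real^'n::finite) set \<Rightarrow> (real^'n \<Rightarrow> real) \<Rightarrow> 'n \<Rightarrow> (real^'n \<Rightarrow> real) \<Rightarrow> bool" where
  "weak_partial \<Omega> f i g \<longleftrightarrow> loc_int \<Omega> f \<and> loc_int \<Omega> g \<and>
     (\<forall>\<phi>. test_fun \<Omega> \<phi> \<longrightarrow>
        (\<integral>x. f x * pd i \<phi> x \<partial>lebesgue_on \<Omega>) = - (\<integral>x. g x * \<phi> x \<partial>lebesgue_on \<Omega>))"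

definition weak_partial2 :: "(real^'n::finite) set \<Rightarrow> (real^'n \<Rightarrow> real) \<Rightarrow> 'n \<Rightarrow> 'n \<Rightarrow> (real^'n \<Rightarrow> real) \<Rightarrow> bool" where
  "weak_partial2 \<Omega> f i j g \<longleftrightarrow> loc_int \<Omega> f \<and> loc_int \<Omega> g \<and>
     (\<forall>\<phi>. test_fun \<Omega> \<phi> \<longrightarrow>
        (\<integral>x. f x * pd i (pd j \<phi>) x \<partial>lebesgue_on \<Omega>) = (\<integral>x. g x * \<phi> x \<partial>lebesgue_on \<Omega>))"

definition L2 :: "(real^'n::finite) set \<Rightarrow> (real^'n \<Rightarrow> 'b::euclidean_space) \<Rightarrow> bool" where
  "L2 \<Omega> f \<longleftrightarrow> f \<in> borel_measurable (lebesgue_on \<Omega>) \<and>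
     integrable (lebesgue_on \<Omega>) (\<lambda>x. (norm (f x))\<^sup>2)"

definition L2norm :: "(real^'n::finite) set \<Rightarrow> (real^'n \<Rightarrow> 'b::euclidean_space) \<Rightarrow> real" where
  "L2norm \<Omega> f = sqrt (\<integral>x. (norm (f x))\<^sup>2 \<partial>lebesgue_on \<Omega>)"

definition H1 :: "(real^'n::finite) set \<Rightarrow> (real^'n \<Rightarrow> real) \<Rightarrow> bool" where
  "H1 \<Omega> f \<longleftrightarrow> L2 \<Omega> f \<and> (\<forall>i. \<exists>g. weak_partial \<Omega> f i g \<and> L2 \<Omega> g)"

definition H2 :: "(real^'n::finite) set \<Rightarrow> (real^'n \<Rightarrow> real) \<Rightarrow> bool" where
  "H2 \<Omega> f \<longleftrightarrow> H1 \<Omega> f \<and> (\<forall>i j. \<exists>g. weak_partial2 \<Omega> f i j g \<and> L2 \<Omega> g)"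

definition H10 :: "(real^'n::finite) set \<Rightarrow> (real^'n \<Rightarrow> real) \<Rightarrow> bool" where
  "H10 \<Omega> f \<longleftrightarrow> H1 \<Omega> f \<and>
     (\<exists>\<phi>::nat \<Rightarrow> real^'n \<Rightarrow> real. (\<forall>k. test_fun \<Omega> (\<phi> k)) \<and>
        (\<lambda>k. L2norm \<Omega> (\<lambda>x. \<phi> k x - f x)) \<longlonglongrightarrow> 0 \<and>
        (\<forall>i g. weak_partial \<Omega> f i g \<longrightarrow> (\<lambda>k. L2norm \<Omega> (\<lambda>x. pd i (\<phi> k) x - g x)) \<longlonglongrightarrow> 0))"

definition H2H10 :: "(real^'n::finite) set \<Rightarrow> (real^'n \<Rightarrow> real^'N::finite) \<Rightarrow> bool" where
  "H2H10 \<Omega> u \<longleftrightarrow> (\<forall>\<alpha>. H2 \<Omega> (\<lambda>x. u x $ \<alpha>) \<and> H10 \<Omega> (\<lambda>x. u x $ \<alpha>))"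

definition weak_hessian :: "(real^'n::finite) set \<Rightarrow> (real^'n \<Rightarrow> real^'N::finite) \<Rightarrow> (real^'n \<Rightarrow> real^'n^'n^'N) \<Rightarrow> bool" where
  "weak_hessian \<Omega> u H \<longleftrightarrow> (\<forall>\<alpha> i j. weak_partial2 \<Omega> (\<lambda>x. u x $ \<alpha>) i j (\<lambda>x. H x $ \<alpha> $ i $ j))"

definition sym_tensors :: "(real^'n^'n^'N::finite) set" where
  "sym_tensors = {X. \<forall>\<alpha> i j. X $ \<alpha> $ i $ j = X $ \<alpha> $ j $ i}"

definition caratheodory :: "(real^'n::finite) set \<Rightarrow> (real^'n \<Rightarrow> real^'n^'n^'N::finite \<Rightarrow> real^'N) \<Rightarrow> bool" where
  "caratheodory \<Omega> F \<longleftrightarrow>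
     (\<forall>X\<in>sym_tensors. (\<lambda>x. F x X) \<in> borel_measurable (lebesgue_on \<Omega>)) \<and>
     (AE x in lebesgue_on \<Omega>. continuous_on sym_tensors (F x))"

text \<open>nu(F): infimum over v, w in (H^2 \<inter> H^1_0)^N with v \<noteq> w (as elements, i.e. not a.e. equal).\<close>
definition nu :: "(real^'n::finite) set \<Rightarrow> (real^'n \<Rightarrow> real^'n^'n^'N::finite \<Rightarrow> real^'N) \<Rightarrow> real" where
  "nu \<Omega> F = Inf {L2norm \<Omega> (\<lambda>x. F x (Hw x) - F x (Hv x)) / L2norm \<Omega> (\<lambda>x. Hw x - Hv x) |
        v w Hv Hw. H2H10 \<Omega> v \<and> H2H10 \<Omega> w \<and> weak_hessian \<Omega> v Hv \<and> weak_hessian \<Omega> w Hw \<and>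
          \<not> (AE x in lebesgue_on \<Omega>. v x = w x)}"

end

theory Submission
  imports Defs "HOL-Computational_Algebra.Polynomial"
begin

text \<open>
  This is Campanato's near-operator argument. For $f \in L^2$ let $u_f$ solve
  $F(\cdot, D^2 u_f) = f$. The Lipschitz bound $k < \nu(F)$ on $F - G$ and the definition of
  $\nu(F)$ make $f \mapsto f - G(\cdot, D^2 u_f) + g$ a contraction of $L^2$ with constant
  $k / \nu(F)$, and at a fixed point $G(\cdot, D^2 u_f) = g$; uniqueness follows from the same
  inequality. The bound on $F - G$ concerns symmetric tensors only, so one needs that weak Hessians
  are symmetric almost everywhere. They also have to be unique and in $L^2$. These facts come from
  the fundamental lemma of the calculus of variations, for which test functions of product form
  suffice.
\<close>

section \<open>Bump functions of product form\<close>

text \<open>The iteration runs on right-hand sides, so the complete space is L^2 itself. Its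
  constant comes from the chain ||(f - h) - (G(., D^2 u_f) - G(., D^2 u_h))|| <= k ||D^2 u_f - D^2
  u_h|| <= (k / nu) ||f - h||, where the last step is the definition of nu applied to u_f and u_h.
  That G(., D^2 u) lies in L^2 is not assumed for general u; it is derived by comparison with the
  zero function, using G(., 0) in L^2 and the bound on F - G.

  The shape of the development is dictated by the fact that functions are not identified almost
  everywhere: a weak Hessian is any member of a relation, and solving an equation means solving it
  off a null set. Hence fixed points are a.e. statements, completeness is proved by hand for
  sequences with geometric steps, and measurability is carried between a.e. equal functions by
  completeness of Lebesgue measure.

  Product test functions suffice because they approximate indicators of boxes, and boxes are an
  intersection-stable generator of the Borel sets.\<close>

primrec diff_real :: "nat \<Rightarrow> (real \<Rightarrow> real) \<Rightarrow> bool" where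
  "diff_real 0 f \<longleftrightarrow> continuous_on UNIV f"
| "diff_real (Suc k) f \<longleftrightarrow> (\<exists>f'. (\<forall>t. (f has_real_derivative f' t) (at t)) \<and> diff_real k f')"

lemma diff_real_Suc: "diff_real (Suc k) f \<Longrightarrow> diff_real k f"
proof (induction k arbitrary: f)
  case 0
  then show ?case by (auto intro: DERIV_continuous_on)
next
  case (Suc k)
  then obtain f' where "\<forall>t. (f has_real_derivative f' t) (at t)" "diff_real (Suc k) f'"
    by (subst (asm) diff_real.simps(2)) blast
  with Suc.IH show ?case unfolding diff_real.simps(2) by blast
qed

lemma diff_real_add:
  "diff_real k f \<Longrightarrow> diff_real k g \<Longrightarrow> diff_real k (\<lambda>t. f t + g t)"
proof (induction k arbitrary: f g)
  case 0
  then show ?case by (auto intro: continuous_intros)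
next
  case (Suc k)
  then obtain f' g' where "\<forall>t. (f has_real_derivative f' t) (at t)" "diff_real k f'"
    "\<forall>t. (g has_real_derivative g' t) (at t)" "diff_real k g'" by auto
  with Suc.IH show ?case
    by (auto intro!: exI[of _ "\<lambda>t. f' t + g' t"] derivative_eq_intros)
qed

lemma diff_real_mult:
  "diff_real k f \<Longrightarrow> diff_real k g \<Longrightarrow> diff_real k (\<lambda>t. f t * g t)"
proof (induction k arbitrary: f g)
  case 0
  then show ?case by (auto intro: continuous_intros)
next
  case (Suc k)
  then obtain f' g' where D: "\<forall>t. (f has_real_derivative f' t) (at t)" "diff_real k f'"
    "\<forall>t. (g has_real_derivative g' t) (at t)" "diff_real k g'" by auto
  have "diff_real k f" "diff_real k g" using Suc.prems diff_real_Suc by blast+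
  with D Suc.IH have "diff_real k (\<lambda>t. f' t * g t + g' t * f t)"
    by (intro diff_real_add) auto
  with D show ?case
    by (auto intro!: exI[of _ "\<lambda>t. f' t * g t + g' t * f t"] DERIV_mult)
qed

lemma diff_real_affine:
  "diff_real k f \<Longrightarrow> diff_real k (\<lambda>t. f (c * t + e))"
proof (induction k arbitrary: f)
  case 0
  then have "continuous_on UNIV (f \<circ> (\<lambda>t. c * t + e))"
    by (intro continuous_on_compose continuous_intros) (auto elim: continuous_on_subset)
  then show ?case by (simp add: o_def)
next
  case (Suc k)
  then obtain f' where D: "\<And>t. (f has_real_derivative f' t) (at t)" "diff_real k f'" by auto
  have "diff_real j (\<lambda>t. c)" for j
    by (induction j arbitrary: c) (auto intro!: exI[of _ "\<lambda>t. 0"] continuous_intros)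
  then have "diff_real k (\<lambda>t. f' (c * t + e) * c)"
    using Suc.IH[OF D(2)] by (intro diff_real_mult) auto
  moreover have "((\<lambda>t. f (c * t + e)) has_real_derivative f' (c * t + e) * c) (at t)" for t
    by (rule DERIV_chain'[of "\<lambda>t. c * t + e" c t UNIV f, OF _ D(1)]) (auto intro!: derivative_eq_intros)
  ultimately show ?case by (auto intro!: exI[of _ "\<lambda>t. f' (c * t + e) * c"])
qed

section \<open>The flat function exp(-1/t) and its derivatives\<close>

definition exp_recip :: "real poly \<Rightarrow> real \<Rightarrow> real" where
  "exp_recip p t = (if t > 0 then poly p (1 / t) * exp (- (1 / t)) else 0)"

lemma poly_exp_minus_tendsto_0:
  fixes p :: "real poly"
  shows "((\<lambda>s. poly p s * exp (- s)) \<longlongrightarrow> 0) at_top"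
proof -
  have "((\<lambda>s. \<Sum>i\<le>degree p. coeff p i * (s ^ i / exp s)) \<longlongrightarrow> (\<Sum>i\<le>degree p. coeff p i * 0)) at_top"
    by (intro tendsto_sum tendsto_mult tendsto_const tendsto_power_div_exp_0)
  then show ?thesis
    by (simp add: poly_altdef sum_distrib_right exp_minus divide_inverse mult.assoc)
qed

text \<open>With s = 1/t, differentiating p(s) exp(-s) in t gives (p(s) - p'(s)) s^2 exp(-s), and
  \<open>[:0, 0, 1:]\<close> is s^2. The polynomial factor is there to make the family closed under
  differentiation, so that smoothness follows by induction over all p at once.\<close>

lemma exp_recip_derivative:
  "(exp_recip p has_real_derivative exp_recip ((p - pderiv p) * [:0, 0, 1:]) t) (at t)"
proof -
  consider "t > 0" | "t < 0" | "t = 0" by linarith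
  then show ?thesis
  proof cases
    case 1
    have "((\<lambda>t. poly p (1 / t) * exp (- (1 / t))) has_real_derivative
        exp_recip ((p - pderiv p) * [:0, 0, 1:]) t) (at t)"
      using 1 by (auto intro!: derivative_eq_intros simp: exp_recip_def field_simps power2_eq_square)
    then show ?thesis
      by (rule has_field_derivative_transform_within_open[where S = "{0<..}"])
        (use 1 in \<open>auto simp: exp_recip_def\<close>)
  next
    case 2
    have "((\<lambda>t. 0) has_real_derivative exp_recip ((p - pderiv p) * [:0, 0, 1:]) t) (at t)"
      using 2 by (simp add: exp_recip_def)
    then show ?thesis
      by (rule has_field_derivative_transform_within_open[where S = "{..<0}"])
        (use 2 in \<open>auto simp: exp_recip_def\<close>)
  next
    case 3
    \<comment> \<open>The value at the origin is 0, so this is the difference quotient there. On the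
      right the substitution s = 1/h turns it into s p(s) exp(-s), the extra s being
      \<open>[:0, 1:]\<close>.\<close>
    have "((\<lambda>h. exp_recip p h / h) \<longlongrightarrow> 0) (at 0)"
      proof (rule filterlim_split_at)
      show "((\<lambda>h. exp_recip p h / h) \<longlongrightarrow> 0) (at_left 0)"
        by (rule tendsto_eventually) (auto simp: exp_recip_def eventually_at_filter)
      have "((\<lambda>s. exp_recip p (inverse s) / inverse s) \<longlongrightarrow> 0) at_top"
      proof (rule Lim_transform_eventually)
        show "((\<lambda>s. poly (p * [:0, 1:]) s * exp (- s)) \<longlongrightarrow> 0) at_top"
          by (rule poly_exp_minus_tendsto_0)
        show "\<forall>\<^sub>F s in at_top. poly (p * [:0, 1:]) s * exp (- s) = exp_recip p (inverse s) / inverse s"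
          using eventually_gt_at_top[of 0] by eventually_elim (auto simp: exp_recip_def field_simps)
      qed
      then show "((\<lambda>h. exp_recip p h / h) \<longlongrightarrow> 0) (at_right 0)"
        unfolding filterlim_at_right_to_top .
    qed
    then show ?thesis
      using 3 by (simp add: has_field_derivative_iff exp_recip_def)
  qed
qed

lemma diff_real_exp_recip: "diff_real k (exp_recip p)"
proof (induction k arbitrary: p)
  case 0
  then show ?case
    using exp_recip_derivative by (auto intro: DERIV_continuous_on)
next
  case (Suc k)
  then show ?case using exp_recip_derivative by auto
qed

lemma diff_real_deriv:
  assumes "\<And>k. diff_real k f"
  shows "(f has_real_derivative deriv f t) (at t)" and "diff_real k (deriv f)"
proof -
  obtain f' where f': "\<forall>t. (f has_real_derivative f' t) (at t)" "diff_real k f'"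
    using assms[of "Suc k"] by auto
  then have "deriv f = f'" using DERIV_imp_deriv by blast
  with f' show "(f has_real_derivative deriv f t) (at t)" "diff_real k (deriv f)" by auto
qed

section \<open>Products of functions of one variable\<close>

definition tensor_fun :: "('n \<Rightarrow> real \<Rightarrow> real) \<Rightarrow> real^'n::finite \<Rightarrow> real" where
  "tensor_fun d x = (\<Prod>i\<in>UNIV. d i (x $ i))"

lemma tensor_fun_has_derivative:
  assumes "\<And>i t. (d i has_real_derivative d' i t) (at t)"
  shows "(tensor_fun d has_derivative
     (\<lambda>y. \<Sum>i\<in>UNIV. d' i (x $ i) * y $ i * (\<Prod>j\<in>UNIV - {i}. d j (x $ j)))) (at x)"
proof -
  have "((\<lambda>x. d i (x $ i)) has_derivative (\<lambda>y. d' i (x $ i) * y $ i)) (at x)" for i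
  proof -
    have "(d i has_derivative (*) (d' i (x $ i))) (at (x $ i))"
      using assms by (auto simp: has_field_derivative_def)
    moreover have "((\<lambda>x. x $ i) has_derivative (\<lambda>y. y $ i)) (at x)"
      by (auto intro: bounded_linear_imp_has_derivative bounded_linear_vec_nth)
    ultimately show ?thesis using has_derivative_compose by blast
  qed
  then show ?thesis
    unfolding tensor_fun_def[abs_def] by (intro has_derivative_prod) auto
qed

text \<open>The axis vector leaves a single summand of the product rule. Partial derivatives
  therefore stay within the product class, which lets the induction of \<open>Ck_tensor_fun\<close>
  close.\<close>

lemma pd_tensor_fun:
  assumes "\<And>i t. (d i has_real_derivative d' i t) (at t)"
  shows "pd k (tensor_fun d) = tensor_fun (d(k := d' k))"
proof
  fix x
  have "pd k (tensor_fun d) x =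
      (\<Sum>i\<in>UNIV. d' i (x $ i) * axis k 1 $ i * (\<Prod>j\<in>UNIV - {i}. d j (x $ j)))"
    unfolding pd_def frechet_derivative_at[OF tensor_fun_has_derivative[of d d' x, OF assms], symmetric] ..
  also have "\<dots> = (\<Sum>i\<in>UNIV. if i = k then d' k (x $ k) * (\<Prod>j\<in>UNIV - {k}. d j (x $ j)) else 0)"
    by (intro sum.cong) (auto simp: axis_def)
  also have "\<dots> = d' k (x $ k) * (\<Prod>j\<in>UNIV - {k}. d j (x $ j))"
    by simp
  also have "\<dots> = tensor_fun (d(k := d' k)) x"
    unfolding tensor_fun_def by (subst (2) prod.remove[of _ k]) auto
  finally show "pd k (tensor_fun d) x = tensor_fun (d(k := d' k)) x" .
qed

lemma Ck_tensor_fun: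
  assumes "\<And>i. diff_real k (d i)"
  shows "Ck k (tensor_fun d)"
  using assms
proof (induction k arbitrary: d)
  case 0
  have "continuous_on UNIV (\<lambda>x::real^'a. d i (x $ i))" for i
  proof (rule continuous_on_compose2[of UNIV "d i"])
    show "continuous_on UNIV (d i)" using 0 by simp
  qed (auto intro: continuous_intros)
  then show ?case
    unfolding tensor_fun_def[abs_def] by (auto intro: continuous_on_prod)
next
  case (Suc k)
  then have "\<exists>f'. (\<forall>t. (d i has_real_derivative f' t) (at t)) \<and> diff_real k f'" for i by simp
  then obtain d' where d': "\<And>i t. (d i has_real_derivative d' i t) (at t)" "\<And>i. diff_real k (d' i)"
    by metis
  have "tensor_fun d differentiable (at x)" for x
    using tensor_fun_has_derivative[of d d' x, OF d'(1)] differentiableI by blast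
  then have *: "tensor_fun d differentiable_on UNIV"
    by (simp add: differentiable_on_def)
  moreover have "Ck k (pd i (tensor_fun d))" for i
    unfolding pd_tensor_fun[of d d', OF d'(1)]
    using d'(2) Suc.prems[THEN diff_real_Suc] by (intro Suc.IH) auto
  ultimately show ?case
    using differentiable_imp_continuous_on by auto
qed

text \<open>For products of functions of one variable the mixed partials agree trivially, so
  Schwarz's theorem is not needed.\<close>

lemma pd_commute_tensor_fun:
  assumes "\<And>i k. diff_real k (d i)"
  shows "pd i (pd j (tensor_fun d)) = pd j (pd i (tensor_fun d))"
proof -
  have P: "pd l (tensor_fun e) = tensor_fun (e(l := deriv (e l)))"
    if "\<And>i k. diff_real k (e i)" for e :: "'a \<Rightarrow> real \<Rightarrow> real" and l
    using that by (intro pd_tensor_fun diff_real_deriv) auto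
  have "pd i (pd j (tensor_fun d)) = tensor_fun (d(j := deriv (d j), i := deriv ((d(j := deriv (d j))) i)))"
    for i j
    using assms diff_real_deriv(2) by (subst P, use assms in force)+ auto
  \<comment> \<open>For distinct i and j the two updates concern different factors and can be
    swapped.\<close>
  then show ?thesis by (cases "i = j") (auto simp: fun_upd_twist)
qed

text \<open>The scaling by \<open>m + 1\<close> replaces $e^{-1/t}$ by its $(m+1)$-st root, so that the bumps
  converge pointwise to the indicator of the box while their supports stay inside it.\<close>

definition bump_factor :: "real^'n \<Rightarrow> real^'n \<Rightarrow> nat \<Rightarrow> 'n \<Rightarrow> real \<Rightarrow> real" where
  "bump_factor a b m i t =
     exp_recip 1 (real (Suc m) * (t - a $ i)) * exp_recip 1 (real (Suc m) * (b $ i - t))"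

lemma diff_real_bump_factor: "diff_real k (bump_factor a b m i)"
proof -
  have "diff_real k (\<lambda>t. exp_recip 1 (real (Suc m) * t + (- real (Suc m) * a $ i)))"
    "diff_real k (\<lambda>t. exp_recip 1 (- real (Suc m) * t + (real (Suc m) * b $ i)))"
    by (rule diff_real_affine[OF diff_real_exp_recip])+
  from diff_real_mult[OF this] show ?thesis
    by (simp add: bump_factor_def[abs_def] algebra_simps)
qed

lemma bump_factor_bounds: "0 \<le> bump_factor a b m i t" "bump_factor a b m i t \<le> 1"
  by (auto simp: bump_factor_def exp_recip_def intro!: mult_le_one)

lemma bump_factor_eq_0: "t \<le> a $ i \<or> b $ i \<le> t \<Longrightarrow> bump_factor a b m i t = 0"
  by (auto simp: bump_factor_def exp_recip_def mult_le_0_iff zero_less_mult_iff)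

lemma bump_factor_tendsto_1:
  assumes "a $ i < t" "t < b $ i"
  shows "(\<lambda>m. bump_factor a b m i t) \<longlonglongrightarrow> 1"
proof -
  have *: "(\<lambda>m. exp_recip 1 (real (Suc m) * c)) \<longlonglongrightarrow> 1" if "c > 0" for c
  proof -
    have "(\<lambda>m. exp (- (inverse (real (Suc m)) * (1 / c)))) \<longlonglongrightarrow> exp (- (0 * (1 / c)))"
      by (intro tendsto_exp tendsto_minus tendsto_mult tendsto_const LIMSEQ_inverse_real_of_nat)
    then show ?thesis using that
      by (simp add: exp_recip_def zero_less_mult_iff field_simps del: of_nat_Suc)
  qed
  have "(\<lambda>m. bump_factor a b m i t) \<longlonglongrightarrow> 1 * 1"
    unfolding bump_factor_def using assms by (intro tendsto_mult *) auto
  then show ?thesis by simp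
qed

lemma tensor_bump_eq_0: "x \<notin> box a b \<Longrightarrow> tensor_fun (bump_factor a b m) x = 0"
  unfolding tensor_fun_def mem_box_cart
  by (auto simp: not_less intro!: bump_factor_eq_0)

lemma tensor_bump_bounds:
  "0 \<le> tensor_fun (bump_factor a b m) x" "tensor_fun (bump_factor a b m) x \<le> 1"
  unfolding tensor_fun_def by (auto intro!: prod_nonneg prod_le_1 simp: bump_factor_bounds)

lemma tensor_bump_tendsto:
  fixes x :: "real^'n::finite"
  shows "(\<lambda>m. tensor_fun (bump_factor a b m) x) \<longlonglongrightarrow> indicator (box a b) x"
proof (cases "x \<in> box a b")
  case True
  then have "(\<lambda>m. bump_factor a b m i (x $ i)) \<longlonglongrightarrow> 1" for i
    by (intro bump_factor_tendsto_1) (auto simp: mem_box_cart)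
  then have "(\<lambda>m. tensor_fun (bump_factor a b m) x) \<longlonglongrightarrow> (\<Prod>i\<in>(UNIV :: 'n set). 1)"
    unfolding tensor_fun_def by (rule tendsto_prod)
  with True show ?thesis by simp
next
  case False
  then show ?thesis by (simp add: tensor_bump_eq_0)
qed

text \<open>The bump vanishes off the open box, but the support is a closure; this is why the closed
  box has to lie in the domain.\<close>

lemma test_fun_tensor_bump:
  assumes "cbox a b \<subseteq> \<Omega>"
  shows "test_fun \<Omega> (tensor_fun (bump_factor a b m))"
proof -
  have "{x. tensor_fun (bump_factor a b m) x \<noteq> 0} \<subseteq> cbox a b"
    using tensor_bump_eq_0 box_subset_cbox by blast
  then have "closure {x. tensor_fun (bump_factor a b m) x \<noteq> 0} \<subseteq> cbox a b"
    by (simp add: closure_minimal closed_cbox)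
  moreover from this have "compact (closure {x. tensor_fun (bump_factor a b m) x \<noteq> 0})"
    using compact_cbox bounded_subset compact_eq_bounded_closed closed_closure by metis
  ultimately show ?thesis
    using assms unfolding test_fun_def smooth_fun_def
    by (auto intro: Ck_tensor_fun diff_real_bump_factor)
qed

section \<open>The fundamental lemma of the calculus of variations\<close>

text \<open>The sets over which the integral vanishes form a Dynkin system containing the boxes,
  hence contain all Borel sets by the pi-lambda theorem; a density whose integrals all vanish is
  zero a.e.\<close>

lemma AE_eq_0_if_box_integrals_eq_0:
  fixes g :: "'a::euclidean_space \<Rightarrow> real"
  assumes int: "integrable (lebesgue_on (cbox a b)) g"
    and zero: "\<And>c d. cbox c d \<subseteq> cbox a b \<Longrightarrow> integral\<^sup>L (lebesgue_on (box c d)) g = 0"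
  shows "AE x in lebesgue_on (cbox a b). g x = 0"
proof -
  \<comment> \<open>Cutting off at the open box keeps everything inside one generator: open boxes
    intersect in open boxes, so each box integral of \<open>h\<close> reduces to the hypothesis. The
    boundary is a null set and is restored at the end.\<close>
  define h where "h x = (if x \<in> box a b then g x else 0)" for x
  have "integrable lebesgue (\<lambda>x. if x \<in> cbox a b then g x else 0)"
    using int by (simp add: Lebesgue_Measure.integrable_restrict_UNIV)
  then have "integrable lebesgue (\<lambda>x. indicator (box a b) x *\<^sub>R (if x \<in> cbox a b then g x else 0))"
    by (intro integrable_mult_indicator) auto
  moreover have "(\<lambda>x. indicator (box a b) x *\<^sub>R (if x \<in> cbox a b then g x else 0)) = h"
    using box_subset_cbox[of a b] by (auto simp: h_def indicator_def fun_eq_iff)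
  ultimately have h: "integrable lebesgue h" by simp
  \<comment> \<open>A Borel representative allows the argument to run on \<open>lborel\<close>,
    whose sets are generated by boxes.\<close>
  then obtain h' where h'[measurable]: "h' \<in> borel_measurable lborel" and eq: "AE x in lborel. h x = h' x"
    using completion_ex_borel_measurable_real[of h lborel] by auto
  then have eq': "AE x in lebesgue. h x = h' x" by (intro AE_completion)
  have "integrable lebesgue h'"
    using integrable_cong_AE[OF borel_measurable_integrable[OF h] measurable_completion[OF h'] eq'] h by simp
  then have int': "integrable lborel h'" using integrable_completion[OF h'] by blast
  have int_ind: "integrable lborel (\<lambda>x. indicator A x *\<^sub>R h' x)" if "A \<in> sets borel" for A
    using integrable_mult_indicator[OF _ int'] that by auto
  have box: "(LINT x:box c d|lborel. h' x) = 0" for c d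
  proof -
    obtain e f where ef: "box c d \<inter> box a b = box e f" by (rule that[OF box_Int_box])
    have "(LINT x:box c d|lborel. h' x) = (\<integral>x. indicator (box c d) x *\<^sub>R h' x \<partial>lebesgue)"
      unfolding set_lebesgue_integral_def by (rule integral_completion[symmetric]) auto
    also have "\<dots> = (\<integral>x. (if x \<in> box e f then g x else 0) \<partial>lebesgue)"
    proof (rule integral_cong_AE)
      show "(\<lambda>x. indicator (box c d) x *\<^sub>R h' x) \<in> borel_measurable lebesgue"
        by (rule measurable_completion) measurable
      have "(\<lambda>x. if x \<in> box e f then g x else 0) = (\<lambda>x. indicator (box c d) x *\<^sub>R h x)"
        unfolding h_def ef[symmetric] by (auto simp: indicator_def)
      also have "\<dots> \<in> borel_measurable lebesgue"
        by (intro borel_measurable_scaleR borel_measurable_indicator borel_measurable_integrable[OF h]) auto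
      finally show "(\<lambda>x. if x \<in> box e f then g x else 0) \<in> borel_measurable lebesgue" .
      show "AE x in lebesgue. indicator (box c d) x *\<^sub>R h' x = (if x \<in> box e f then g x else 0)"
        using eq' by eventually_elim (auto simp: ef[symmetric] h_def indicator_def)
    qed
    also have "\<dots> = integral\<^sup>L (lebesgue_on (box e f)) g"
      by (rule Lebesgue_Measure.integral_restrict_UNIV) auto
    also have "\<dots> = 0"
    \<comment> \<open>An empty open box can have a nonempty, flat closed box that leaves
      \<open>cbox a b\<close>. If the open box is nonempty, its closure is the closed box and the
      hypothesis applies.\<close>
    proof (cases "box e f = {}")
      case False
      have "box e f \<subseteq> cbox a b"
        unfolding ef[symmetric] using box_subset_cbox[of a b] by (rule le_infI2)
      then have "cbox e f \<subseteq> cbox a b"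
        unfolding closure_box[OF False, symmetric] by (intro closure_minimal closed_cbox)
      then show ?thesis by (rule zero)
    qed auto
    finally show ?thesis .
  qed
  \<comment> \<open>The complement step of the induction needs the integral over the whole space; it
    reduces to one box because \<open>h'\<close> vanishes a.e. outside
    \<open>box a b\<close>.\<close>
  have whole: "(\<integral>x. h' x \<partial>lborel) = 0"
  proof -
    have "(\<integral>x. h' x \<partial>lborel) = (LINT x:box a b|lborel. h' x)"
      unfolding set_lebesgue_integral_def
    proof (rule integral_cong_AE)
      show "AE x in lborel. h' x = indicator (box a b) x *\<^sub>R h' x"
        using eq by eventually_elim (simp add: h_def indicator_def split: if_splits)
    qed measurable
    then show ?thesis using box by simp
  qed
  have "(LINT x:A|lborel. h' x) = 0" if "A \<in> sets lborel" for A
  proof -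
    let ?G = "range (\<lambda>(a, b). box a b :: 'a set)"
    have "Int_stable ?G"
      unfolding Int_stable_def
    proof safe
      fix a b c d :: 'a
      show "box a b \<inter> box c d \<in> ?G" unfolding box_Int_box by auto
    qed
    moreover have "?G \<subseteq> Pow UNIV" by simp
    moreover have "A \<in> sigma_sets UNIV ?G"
      using that by (simp add: borel_eq_box)
    ultimately show ?thesis
    proof (induction rule: sigma_sets_induct_disjoint)
      case (basic A)
      then show ?case using box by auto
    next
      case empty
      show ?case by (simp add: set_lebesgue_integral_def)
    next
      case (compl A)
      then have A: "A \<in> sets borel" by (simp add: borel_eq_box)
      have "(LINT x:UNIV - A|lborel. h' x) = (\<integral>x. h' x - indicator A x *\<^sub>R h' x \<partial>lborel)"
        unfolding set_lebesgue_integral_def by (intro Bochner_Integration.integral_cong) (auto simp: indicator_def)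
      also have "\<dots> = 0"
        using compl(2) whole int' int_ind[OF A] by (simp add: set_lebesgue_integral_def)
      finally show ?case .
    next
      case (union A)
      have "A i \<in> sigma_sets UNIV ?G" for i using union(2) by blast
      then have A: "A i \<in> sets borel" for i by (simp add: borel_eq_box)
      have "(LINT x:(\<Union>i. A i)|lborel. h' x) = (\<Sum>i. (LINT x:A i|lborel. h' x))"
      proof (rule lebesgue_integral_countable_add)
        show "A i \<in> sets lborel" for i using A by simp
        show "A i \<inter> A j = {}" if "i \<noteq> j" for i j
          using union(1) that by (simp add: disjoint_family_on_def)
        show "set_integrable lborel (\<Union>i. A i) h'"
          unfolding set_integrable_def using A by (intro int_ind) auto
      qed
      then show ?case using union(3) by simp
    qed
  qed
  then have "AE x in lborel. h' x = 0" 
    by (intro density_unique_real[of lborel h' "\<lambda>x. 0"] int') (auto simp: set_lebesgue_integral_def)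
  then have "AE x in lborel. h x = 0" using eq by eventually_elim auto
  then have "AE x in lebesgue. h x = 0" by (rule AE_completion)
  moreover have "AE x in lebesgue. x \<notin> cbox a b - box a b"
    by (intro AE_not_in) (simp add: negligible_iff_null_sets[symmetric] negligible_frontier_interval)
  ultimately have "AE x in lebesgue. x \<in> cbox a b \<longrightarrow> g x = 0"
    by eventually_elim (auto simp: h_def)
  then show ?thesis by (simp add: AE_restrict_space_iff)
qed

lemma test_fun_continuous: "test_fun \<Omega> \<phi> \<Longrightarrow> continuous_on UNIV \<phi>"
  by (auto simp: test_fun_def smooth_fun_def dest: spec[of _ 0])

text \<open>Local integrability speaks of compact sets only, so the product is integrated over the
  support of the test function, where the latter is bounded, and then extended by zero.\<close>

lemma integrable_mult_test_fun:
  assumes "loc_int \<Omega> g" "test_fun \<Omega> \<phi>" "\<Omega> \<in> sets lebesgue"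
  shows "integrable (lebesgue_on \<Omega>) (\<lambda>x. g x * \<phi> x)"
proof -
  define K where "K = closure {x. \<phi> x \<noteq> 0}"
  have K: "compact K" "K \<subseteq> \<Omega>"
    using assms(2) by (auto simp: test_fun_def K_def)
  have out: "\<phi> x = 0" if "x \<notin> K" for x
    using that closure_subset[of "{x. \<phi> x \<noteq> 0}"] by (auto simp: K_def)
  have meas: "K \<in> sets lebesgue"
    using compact_imp_closed[OF K(1)] by (intro sets_completionI_sets) simp
  have g: "integrable (lebesgue_on K) g"
    using assms(1) K unfolding loc_int_def by auto
  have cont: "continuous_on K \<phi>"
    using test_fun_continuous[OF assms(2)] continuous_on_subset by blast
  then have "bounded (\<phi> ` K)"
    using K(1) compact_continuous_image compact_imp_bounded by blast
  then obtain B where B: "\<And>x. x \<in> K \<Longrightarrow> \<bar>\<phi> x\<bar> \<le> B"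
    unfolding bounded_iff by auto
  have [measurable]: "\<phi> \<in> borel_measurable (lebesgue_on K)"
    using continuous_imp_measurable_on_sets_lebesgue[OF cont meas] .
  have "integrable (lebesgue_on K) (\<lambda>x. g x * \<phi> x)"
  proof (rule Bochner_Integration.integrable_bound)
    show "integrable (lebesgue_on K) (\<lambda>x. B * g x)" using g by simp
    show "(\<lambda>x. g x * \<phi> x) \<in> borel_measurable (lebesgue_on K)" using g by measurable
    show "AE x in lebesgue_on K. norm (g x * \<phi> x) \<le> norm (B * g x)"
    proof (rule AE_I2)
      fix x assume "x \<in> space (lebesgue_on K)"
      then have "\<bar>\<phi> x\<bar> \<le> \<bar>B\<bar>" using B[of x] by simp
      then show "norm (g x * \<phi> x) \<le> norm (B * g x)"
        by (simp add: abs_mult mult.commute mult_right_mono)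
    qed
  qed
  then have "integrable lebesgue (\<lambda>x. if x \<in> K then g x * \<phi> x else 0)"
    by (simp add: Lebesgue_Measure.integrable_restrict_UNIV[OF meas])
  moreover have "(\<lambda>x. if x \<in> K then g x * \<phi> x else 0) = (\<lambda>x. if x \<in> \<Omega> then g x * \<phi> x else 0)"
    using out K(2) by (auto simp: fun_eq_iff)
  ultimately show ?thesis
    by (simp add: Lebesgue_Measure.integrable_restrict_UNIV[OF assms(3)])
qed

text \<open>The product bumps lie in [0, 1] and tend to the indicator of a box, so dominated
  convergence with bound |g| makes all box integrals vanish. Restricting the tests to smooth
  products keeps commuting mixed partials available to the symmetry argument.\<close>

lemma fundamental_lemma_tensor:
  assumes "open \<Omega>" "loc_int \<Omega> g"
    and zero: "\<And>d. (\<And>i k. diff_real k (d i)) \<Longrightarrow> test_fun \<Omega> (tensor_fun d) \<Longrightarrow>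
      (\<integral>x. g x * tensor_fun d x \<partial>lebesgue_on \<Omega>) = 0"
  shows "AE x in lebesgue_on \<Omega>. g x = 0"
proof -
  have meas: "\<Omega> \<in> sets lebesgue" using assms(1) by simp
  have box: "integral\<^sup>L (lebesgue_on (box a b)) g = 0" if ab: "cbox a b \<subseteq> \<Omega>" for a b
  proof -
    define s where "s m x = g x * tensor_fun (bump_factor a b m) x" for m x
    have g: "integrable (lebesgue_on (cbox a b)) g"
      using assms(2) ab by (auto simp: loc_int_def)
    have test: "test_fun \<Omega> (tensor_fun (bump_factor a b m))" for m
      by (rule test_fun_tensor_bump[OF ab])
    have out: "x \<notin> cbox a b \<Longrightarrow> s m x = 0" for x m
      using tensor_bump_eq_0 box_subset_cbox unfolding s_def by (metis mult_zero_right subsetD)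
    have "integral\<^sup>L (lebesgue_on (cbox a b)) (s m) = 0" for m
    proof -
      have "integral\<^sup>L (lebesgue_on (cbox a b)) (s m) =
          integral\<^sup>L (lebesgue_on \<Omega>) (\<lambda>x. if x \<in> cbox a b then s m x else 0)"
        using ab meas by (intro Lebesgue_Measure.integral_restrict[symmetric]) auto
      also have "(\<lambda>x. if x \<in> cbox a b then s m x else 0) = s m"
        using out by auto
      finally show ?thesis
        using zero[OF diff_real_bump_factor test] unfolding s_def by metis
    qed
    moreover have "(\<lambda>m. integral\<^sup>L (lebesgue_on (cbox a b)) (s m)) \<longlonglongrightarrow>
        integral\<^sup>L (lebesgue_on (cbox a b)) (\<lambda>x. g x * indicator (box a b) x)"
    proof (rule integral_dominated_convergence)
      show "integrable (lebesgue_on (cbox a b)) (\<lambda>x. norm (g x))" using g by simp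
      show "(\<lambda>x. g x * indicator (box a b) x) \<in> borel_measurable (lebesgue_on (cbox a b))"
        by (intro borel_measurable_times borel_measurable_indicator)
          (use g in \<open>auto simp: sets_restrict_space_iff box_subset_cbox\<close>)
      have [measurable]: "tensor_fun (bump_factor a b m) \<in> borel_measurable (lebesgue_on (cbox a b))" for m
        using test_fun_continuous[OF test, of m]
        by (intro continuous_imp_measurable_on_sets_lebesgue) (auto elim: continuous_on_subset)
      show "s m \<in> borel_measurable (lebesgue_on (cbox a b))" for m
        using g unfolding s_def by measurable
      show "AE x in lebesgue_on (cbox a b). (\<lambda>m. s m x) \<longlonglongrightarrow> g x * indicator (box a b) x"
        unfolding s_def by (intro AE_I2 tendsto_mult tendsto_const tensor_bump_tendsto)
      show "AE x in lebesgue_on (cbox a b). norm (s m x) \<le> norm (g x)" for m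
        unfolding s_def using tensor_bump_bounds[of a b m]
        by (intro AE_I2) (auto simp: abs_mult intro!: mult_left_le)
    qed
    ultimately have "integral\<^sup>L (lebesgue_on (cbox a b)) (\<lambda>x. g x * indicator (box a b) x) = 0"
      by (simp add: LIMSEQ_const_iff)
    also have "(\<lambda>x. g x * indicator (box a b) x) = (\<lambda>x. if x \<in> box a b then g x else 0)"
      by (auto simp: indicator_def)
    finally show ?thesis
      by (subst (asm) Lebesgue_Measure.integral_restrict) (auto simp: box_subset_cbox)
  qed
  have cbox: "AE x in lebesgue. x \<in> cbox a b \<longrightarrow> g x = 0" if "cbox a b \<subseteq> \<Omega>" for a b
  proof -
    have "AE x in lebesgue_on (cbox a b). g x = 0"
      using assms(2) that by (intro AE_eq_0_if_box_integrals_eq_0 box) (auto simp: loc_int_def)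
    then show ?thesis by (simp add: AE_restrict_space_iff)
  qed
  \<comment> \<open>Countably many closed boxes exhaust the domain, so their exceptional null sets
    can be united.\<close>
  obtain \<D> where \<D>: "countable \<D>" "\<D> \<subseteq> Pow \<Omega>" "\<And>X. X \<in> \<D> \<Longrightarrow> \<exists>a b. X = cbox a b" "\<Union>\<D> = \<Omega>"
    using open_countable_Union_open_cbox[OF assms(1)] by metis
  have "AE x in lebesgue. \<forall>X\<in>\<D>. x \<in> X \<longrightarrow> g x = 0"
    unfolding AE_ball_countable[OF \<D>(1)]
  proof
    fix X assume X: "X \<in> \<D>"
    then obtain a b where "X = cbox a b" using \<D>(3) by blast
    with X \<D>(2) show "AE x in lebesgue. x \<in> X \<longrightarrow> g x = 0"
      using cbox[of a b] by auto
  qed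
  then have "AE x in lebesgue. x \<in> \<Omega> \<longrightarrow> g x = 0"
    by eventually_elim (use \<D>(4) in auto)
  then show ?thesis using meas by (simp add: AE_restrict_space_iff)
qed

lemma loc_int_diff: "loc_int \<Omega> f \<Longrightarrow> loc_int \<Omega> g \<Longrightarrow> loc_int \<Omega> (\<lambda>x. f x - g x)"
  unfolding loc_int_def by auto

lemma fundamental_lemma_eq:
  assumes "open \<Omega>" and f: "loc_int \<Omega> f" and g: "loc_int \<Omega> g"
    and eq: "\<And>d. (\<And>i k. diff_real k (d i)) \<Longrightarrow> test_fun \<Omega> (tensor_fun d) \<Longrightarrow>
      (\<integral>x. f x * tensor_fun d x \<partial>lebesgue_on \<Omega>) = (\<integral>x. g x * tensor_fun d x \<partial>lebesgue_on \<Omega>)"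
  shows "AE x in lebesgue_on \<Omega>. f x = g x"
proof -
  have "AE x in lebesgue_on \<Omega>. f x - g x = 0"
  proof (rule fundamental_lemma_tensor[OF assms(1)])
    show "loc_int \<Omega> (\<lambda>x. f x - g x)" using f g by (rule loc_int_diff)
    fix d :: "'a \<Rightarrow> real \<Rightarrow> real"
    assume d: "\<And>i k. diff_real k (d i)" and t: "test_fun \<Omega> (tensor_fun d)"
    show "(\<integral>x. (f x - g x) * tensor_fun d x \<partial>lebesgue_on \<Omega>) = 0"
      using eq[OF d t] integrable_mult_test_fun[OF f t] integrable_mult_test_fun[OF g t] assms(1)
      by (simp add: left_diff_distrib)
  qed
  then show ?thesis by simp
qed

lemma weak_partial_unique:
  assumes "open \<Omega>" "weak_partial \<Omega> f i g" "weak_partial \<Omega> f i g'"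
  shows "AE x in lebesgue_on \<Omega>. g x = g' x"
  using assms unfolding weak_partial_def by (intro fundamental_lemma_eq) auto

text \<open>This is completeness of Lebesgue measure, applied to the extensions by zero.\<close>

lemma borel_measurable_lebesgue_on_AE:
  fixes f g :: "'a::euclidean_space \<Rightarrow> 'b::euclidean_space"
  assumes f: "f \<in> borel_measurable (lebesgue_on S)" and S: "S \<in> sets lebesgue"
    and ae: "AE x in lebesgue_on S. f x = g x"
  shows "g \<in> borel_measurable (lebesgue_on S)"
proof -
  have "AE x in lebesgue. x \<in> S \<longrightarrow> f x = g x"
    using ae S by (simp add: AE_restrict_space_iff)
  then have "AE x in lebesgue. (if x \<in> S then f x else 0) = (if x \<in> S then g x else 0)"
    by eventually_elim auto
  then have "(\<lambda>x. if x \<in> S then g x else 0) \<in> borel_measurable lebesgue"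
    by (rule borel_measurable_AE[OF borel_measurable_if_I[OF f S]])
  then show ?thesis by (rule borel_measurable_if_D)
qed

text \<open>By completeness both functions are measurable or neither is; in the second case neither
  is integrable and both integrals take the default value 0.\<close>

lemma integral_lebesgue_on_cong_AE:
  fixes f g :: "'a::euclidean_space \<Rightarrow> 'b::euclidean_space"
  assumes S: "S \<in> sets lebesgue" and ae: "AE x in lebesgue_on S. f x = g x"
  shows "integral\<^sup>L (lebesgue_on S) f = integral\<^sup>L (lebesgue_on S) g"
proof (cases "f \<in> borel_measurable (lebesgue_on S)")
  case True
  then show ?thesis
    using ae borel_measurable_lebesgue_on_AE[OF True S ae] by (intro integral_cong_AE)
next
  case False
  have "AE x in lebesgue_on S. g x = f x" using ae by eventually_elim simp
  with False have "g \<notin> borel_measurable (lebesgue_on S)"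
    using borel_measurable_lebesgue_on_AE[OF _ S] by blast
  with False show ?thesis
    by (metis borel_measurable_integrable not_integrable_integral_eq)
qed

text \<open>Two a.e. equal functions are allowed, since elements of the solution space are compared
  only up to null sets.\<close>

lemma weak_partial2_unique:
  assumes "open \<Omega>" "AE x in lebesgue_on \<Omega>. f x = f' x"
    and g: "weak_partial2 \<Omega> f i j g" and g': "weak_partial2 \<Omega> f' i j g'"
  shows "AE x in lebesgue_on \<Omega>. g x = g' x"
proof (rule fundamental_lemma_eq[OF assms(1)])
  show "loc_int \<Omega> g" "loc_int \<Omega> g'" using g g' by (auto simp: weak_partial2_def)
  fix d :: "'a \<Rightarrow> real \<Rightarrow> real"
  let ?\<phi> = "tensor_fun d"
  assume "test_fun \<Omega> ?\<phi>"
  moreover have "(\<integral>x. f x * pd i (pd j ?\<phi>) x \<partial>lebesgue_on \<Omega>) = (\<integral>x. f' x * pd i (pd j ?\<phi>) x \<partial>lebesgue_on \<Omega>)"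
    using assms(1,2) by (intro integral_lebesgue_on_cong_AE) (auto elim: eventually_mono)
  ultimately show "(\<integral>x. g x * ?\<phi> x \<partial>lebesgue_on \<Omega>) = (\<integral>x. g' x * ?\<phi> x \<partial>lebesgue_on \<Omega>)"
    using g g' unfolding weak_partial2_def by metis
qed

text \<open>Against a product test function both derivatives give the integral of f times the same
  mixed partial, so the fundamental lemma identifies them.\<close>

lemma weak_partial2_symmetric:
  assumes "open \<Omega>" "weak_partial2 \<Omega> f i j g" "weak_partial2 \<Omega> f j i g'"
  shows "AE x in lebesgue_on \<Omega>. g x = g' x"
  using assms unfolding weak_partial2_def
  by (intro fundamental_lemma_eq) (auto simp: pd_commute_tensor_fun)

section \<open>The space $L^2$\<close>

lemma L2_measurable: "L2 \<Omega> f \<Longrightarrow> f \<in> borel_measurable (lebesgue_on \<Omega>)"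
  and L2_integrable: "L2 \<Omega> f \<Longrightarrow> integrable (lebesgue_on \<Omega>) (\<lambda>x. (norm (f x))\<^sup>2)"
  by (auto simp: L2_def)

lemma L2norm_nonneg [simp]: "0 \<le> L2norm \<Omega> f"
  by (simp add: L2norm_def)

lemma L2norm_power2: "(L2norm \<Omega> f)\<^sup>2 = (\<integral>x. (norm (f x))\<^sup>2 \<partial>lebesgue_on \<Omega>)"
  by (simp add: L2norm_def)

lemma L2norm_zero [simp]: "L2norm \<Omega> (\<lambda>x. 0) = 0"
  by (simp add: L2norm_def)

lemma L2_zero [simp]: "L2 \<Omega> (\<lambda>x. 0)"
  by (simp add: L2_def)

lemma L2norm_minus_commute: "L2norm \<Omega> (\<lambda>x. f x - g x) = L2norm \<Omega> (\<lambda>x. g x - f x)"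
  by (simp add: L2norm_def norm_minus_commute)

lemma L2norm_cong_AE:
  assumes "\<Omega> \<in> sets lebesgue" "AE x in lebesgue_on \<Omega>. f x = g x"
  shows "L2norm \<Omega> f = L2norm \<Omega> g"
  unfolding L2norm_def using assms
  by (intro arg_cong[of _ _ sqrt] integral_lebesgue_on_cong_AE) (auto elim: eventually_mono)

lemma L2_bound:
  assumes "f \<in> borel_measurable (lebesgue_on \<Omega>)" "L2 \<Omega> g"
    and "AE x in lebesgue_on \<Omega>. norm (f x) \<le> norm (g x)"
  shows "L2 \<Omega> f"
  unfolding L2_def
proof
  note assms(1)[measurable]
  show "integrable (lebesgue_on \<Omega>) (\<lambda>x. (norm (f x))\<^sup>2)"
  proof (rule Bochner_Integration.integrable_bound[OF L2_integrable[OF assms(2)]])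
    show "AE x in lebesgue_on \<Omega>. norm ((norm (f x))\<^sup>2) \<le> norm ((norm (g x))\<^sup>2)"
      using assms(3) by eventually_elim (simp add: power_mono)
  qed measurable
qed fact

lemma L2_cong_AE:
  assumes "\<Omega> \<in> sets lebesgue" "L2 \<Omega> f" "AE x in lebesgue_on \<Omega>. f x = g x"
  shows "L2 \<Omega> g"
proof (rule L2_bound)
  show "g \<in> borel_measurable (lebesgue_on \<Omega>)"
    by (rule borel_measurable_lebesgue_on_AE[OF L2_measurable[OF assms(2)] assms(1,3)])
  show "AE x in lebesgue_on \<Omega>. norm (g x) \<le> norm (f x)"
    using assms(3) by eventually_elim simp
qed fact

lemma L2_scaleR: "L2 \<Omega> f \<Longrightarrow> L2 \<Omega> (\<lambda>x. c *\<^sub>R f x)"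
  by (auto simp: L2_def power_mult_distrib)

text \<open>Young's inequality with a free parameter: the defect is the square (e |a| - |b|)^2 / e.
  The value e = 1 gives closure of L^2 under sums, and an optimal e gives the triangle
  inequality.\<close>

lemma power2_norm_add_le:
  fixes a b :: "'a::real_normed_vector"
  assumes "e > 0"
  shows "(norm (a + b))\<^sup>2 \<le> (1 + e) * (norm a)\<^sup>2 + (1 + 1 / e) * (norm b)\<^sup>2"
proof -
  have "(norm (a + b))\<^sup>2 \<le> (norm a + norm b)\<^sup>2"
    by (intro power_mono norm_triangle_ineq) simp
  also have "\<dots> = (1 + e) * (norm a)\<^sup>2 + (1 + 1 / e) * (norm b)\<^sup>2 - (e * norm a - norm b)\<^sup>2 / e"
    using assms by (simp add: power2_eq_square field_simps)
  finally show ?thesis using assms by (smt (verit) divide_nonneg_pos zero_le_power2)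
qed

lemma L2_add:
  assumes "L2 \<Omega> f" "L2 \<Omega> g"
  shows "L2 \<Omega> (\<lambda>x. f x + g x)"
  unfolding L2_def
proof
  note L2_measurable[OF assms(1), measurable] L2_measurable[OF assms(2), measurable]
  show "(\<lambda>x. f x + g x) \<in> borel_measurable (lebesgue_on \<Omega>)"
    by measurable
  show "integrable (lebesgue_on \<Omega>) (\<lambda>x. (norm (f x + g x))\<^sup>2)"
  proof (rule Bochner_Integration.integrable_bound[of _ "\<lambda>x. 2 * (norm (f x))\<^sup>2 + 2 * (norm (g x))\<^sup>2"])
    show "integrable (lebesgue_on \<Omega>) (\<lambda>x. 2 * (norm (f x))\<^sup>2 + 2 * (norm (g x))\<^sup>2)"
      using assms by (intro Bochner_Integration.integrable_add integrable_mult_right L2_integrable)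
    show "AE x in lebesgue_on \<Omega>. norm ((norm (f x + g x))\<^sup>2) \<le> norm (2 * (norm (f x))\<^sup>2 + 2 * (norm (g x))\<^sup>2)"
      using power2_norm_add_le[of 1] by (intro AE_I2) auto
  qed measurable
qed

lemma L2_diff: "L2 \<Omega> f \<Longrightarrow> L2 \<Omega> g \<Longrightarrow> L2 \<Omega> (\<lambda>x. f x - g x)"
  using L2_add[OF _ L2_scaleR[of \<Omega> g "-1"]] by simp

lemma L2norm_eq_0_iff:
  assumes "L2 \<Omega> f"
  shows "L2norm \<Omega> f = 0 \<longleftrightarrow> (AE x in lebesgue_on \<Omega>. f x = 0)"
  using integral_nonneg_eq_0_iff_AE[OF L2_integrable[OF assms]] by (simp add: L2norm_def)

lemma L2norm_mono:
  assumes f: "L2 \<Omega> f" and g: "L2 \<Omega> g" and "c \<ge> 0"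
    and le: "AE x in lebesgue_on \<Omega>. norm (f x) \<le> c * norm (g x)"
  shows "L2norm \<Omega> f \<le> c * L2norm \<Omega> g"
proof (rule power2_le_imp_le)
  have "(L2norm \<Omega> f)\<^sup>2 \<le> (\<integral>x. c\<^sup>2 * (norm (g x))\<^sup>2 \<partial>lebesgue_on \<Omega>)"
    unfolding L2norm_power2
  proof (rule integral_mono_AE)
    show "AE x in lebesgue_on \<Omega>. (norm (f x))\<^sup>2 \<le> c\<^sup>2 * (norm (g x))\<^sup>2"
      using le by eventually_elim (metis norm_ge_zero power_mono power_mult_distrib)
  qed (use f g in \<open>auto intro: L2_integrable\<close>)
  then show "(L2norm \<Omega> f)\<^sup>2 \<le> (c * L2norm \<Omega> g)\<^sup>2"
    by (simp add: L2norm_power2 power_mult_distrib)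
qed (use assms in simp)

lemma L2norm_add_le:
  assumes f: "L2 \<Omega> f" and g: "L2 \<Omega> g" and meas: "\<Omega> \<in> sets lebesgue"
  shows "L2norm \<Omega> (\<lambda>x. f x + g x) \<le> L2norm \<Omega> f + L2norm \<Omega> g"
proof -
  consider "L2norm \<Omega> f = 0" | "L2norm \<Omega> g = 0" | "L2norm \<Omega> f > 0" "L2norm \<Omega> g > 0"
    using L2norm_nonneg[of \<Omega> f] L2norm_nonneg[of \<Omega> g] by linarith
  then show ?thesis
  proof cases
    case 1
    then have "AE x in lebesgue_on \<Omega>. f x + g x = g x"
      using L2norm_eq_0_iff[OF f] by auto
    then have "L2norm \<Omega> (\<lambda>x. f x + g x) = L2norm \<Omega> g" by (rule L2norm_cong_AE[OF meas])
    then show ?thesis by simp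
  next
    case 2
    then have "AE x in lebesgue_on \<Omega>. f x + g x = f x"
      using L2norm_eq_0_iff[OF g] by auto
    then have "L2norm \<Omega> (\<lambda>x. f x + g x) = L2norm \<Omega> f" by (rule L2norm_cong_AE[OF meas])
    then show ?thesis by simp
  next
    case 3
    \<comment> \<open>This ratio minimises the bound and turns it into the perfect square of the sum
      of the norms. Vanishing norms were split off because e and 1 / e must both make sense.\<close>
    define e where "e = L2norm \<Omega> g / L2norm \<Omega> f"
    have e: "e > 0" using 3 by (simp add: e_def)
    have "(L2norm \<Omega> (\<lambda>x. f x + g x))\<^sup>2 \<le>
        (\<integral>x. (1 + e) * (norm (f x))\<^sup>2 + (1 + 1 / e) * (norm (g x))\<^sup>2 \<partial>lebesgue_on \<Omega>)"
      unfolding L2norm_power2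
      by (rule integral_mono)
        (auto intro!: L2_integrable L2_add f g power2_norm_add_le e Bochner_Integration.integrable_add integrable_mult_right)
    also have "\<dots> = (1 + e) * (L2norm \<Omega> f)\<^sup>2 + (1 + 1 / e) * (L2norm \<Omega> g)\<^sup>2"
      using L2_integrable[OF f] L2_integrable[OF g] by (simp add: L2norm_power2)
    also have "\<dots> = (L2norm \<Omega> f + L2norm \<Omega> g)\<^sup>2"
      using 3 by (simp add: e_def power2_eq_square field_simps)
    finally show ?thesis by (rule power2_le_imp_le) simp
  qed
qed

lemma L2norm_triangle:
  assumes "L2 \<Omega> f" "L2 \<Omega> g" "L2 \<Omega> h" "\<Omega> \<in> sets lebesgue"
  shows "L2norm \<Omega> (\<lambda>x. f x - h x) \<le> L2norm \<Omega> (\<lambda>x. f x - g x) + L2norm \<Omega> (\<lambda>x. g x - h x)"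
  using L2norm_add_le[of \<Omega> "\<lambda>x. f x - g x" "\<lambda>x. g x - h x"] assms by (simp add: L2_diff)

lemma nn_integral_power2_norm:
  assumes "L2 \<Omega> f"
  shows "(\<integral>\<^sup>+x. ennreal ((norm (f x))\<^sup>2) \<partial>lebesgue_on \<Omega>) = ennreal ((L2norm \<Omega> f)\<^sup>2)"
  unfolding L2norm_power2 using L2_integrable[OF assms] by (intro nn_integral_eq_integral) auto

text \<open>Fatou's lemma for the squared norms, run in extended nonnegative integrals so that
  integrability of the limit comes out as a conclusion.\<close>

lemma L2_Fatou:
  fixes f :: "nat \<Rightarrow> real^'n::finite \<Rightarrow> 'b::euclidean_space"
  assumes f: "\<And>m. L2 \<Omega> (f m)" and le: "\<And>m. L2norm \<Omega> (f m) \<le> B"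
    and g: "g \<in> borel_measurable (lebesgue_on \<Omega>)"
    and lim: "AE x in lebesgue_on \<Omega>. (\<lambda>m. f m x) \<longlonglongrightarrow> g x"
  shows "L2 \<Omega> g" "L2norm \<Omega> g \<le> B"
proof -
  have B: "0 \<le> B" using order_trans[OF L2norm_nonneg le] .
  have [measurable]: "f m \<in> borel_measurable (lebesgue_on \<Omega>)" for m
    using f by (rule L2_measurable)
  note g[measurable]
  have "(\<integral>\<^sup>+x. ennreal ((norm (g x))\<^sup>2) \<partial>lebesgue_on \<Omega>) =
      (\<integral>\<^sup>+x. liminf (\<lambda>m. ennreal ((norm (f m x))\<^sup>2)) \<partial>lebesgue_on \<Omega>)"
  proof (rule nn_integral_cong_AE)
    show "AE x in lebesgue_on \<Omega>. ennreal ((norm (g x))\<^sup>2) = liminf (\<lambda>m. ennreal ((norm (f m x))\<^sup>2))"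
      using lim
    proof eventually_elim
      case (elim x)
      then have "(\<lambda>m. ennreal ((norm (f m x))\<^sup>2)) \<longlonglongrightarrow> ennreal ((norm (g x))\<^sup>2)"
        by (intro tendsto_ennrealI tendsto_power tendsto_norm)
      then show ?case by (rule lim_imp_Liminf[OF trivial_limit_sequentially, symmetric])
    qed
  qed
  also have "\<dots> \<le> liminf (\<lambda>m. \<integral>\<^sup>+x. ennreal ((norm (f m x))\<^sup>2) \<partial>lebesgue_on \<Omega>)"
    by (rule nn_integral_liminf) measurable
  also have "\<dots> \<le> liminf (\<lambda>m::nat. ennreal (B\<^sup>2))"
  proof (rule Liminf_mono[OF always_eventually[OF allI]])
    show "(\<integral>\<^sup>+x. ennreal ((norm (f m x))\<^sup>2) \<partial>lebesgue_on \<Omega>) \<le> ennreal (B\<^sup>2)" for m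
      unfolding nn_integral_power2_norm[OF f] by (intro ennreal_leI power_mono le L2norm_nonneg)
  qed
  finally have *: "(\<integral>\<^sup>+x. ennreal ((norm (g x))\<^sup>2) \<partial>lebesgue_on \<Omega>) \<le> ennreal (B\<^sup>2)"
    by (simp add: Liminf_const)
  have "integrable (lebesgue_on \<Omega>) (\<lambda>x. (norm (g x))\<^sup>2)"
  proof (rule integrableI_bounded)
    show "(\<integral>\<^sup>+x. ennreal (norm ((norm (g x))\<^sup>2)) \<partial>lebesgue_on \<Omega>) < \<infinity>"
      using le_less_trans[OF * ennreal_less_top] by simp
  qed measurable
  then show L2: "L2 \<Omega> g" using g by (simp add: L2_def)
  have "(L2norm \<Omega> g)\<^sup>2 \<le> B\<^sup>2"
    using * unfolding nn_integral_power2_norm[OF L2] by (subst (asm) ennreal_le_iff) auto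
  then show "L2norm \<Omega> g \<le> B" using B by (rule power2_le_imp_le)
qed

text \<open>The weight $q^{-n}$ keeps \<open>\<Sum>n. |f (n+1) - f n|\<^sup>2 / q ^ n\<close> integrable, hence finite almost
  everywhere; there the steps are dominated by a multiple of $\sqrt{q}^n$.\<close>

lemma AE_convergent_if_geometric_L2:
  fixes f :: "nat \<Rightarrow> real^'n::finite \<Rightarrow> 'b::euclidean_space"
  assumes f: "\<And>n. L2 \<Omega> (f n)" and q: "0 < q" "q < 1"
    and step: "\<And>n. L2norm \<Omega> (\<lambda>x. f (Suc n) x - f n x) \<le> C * q ^ n"
  shows "AE x in lebesgue_on \<Omega>. convergent (\<lambda>n. f n x)"
proof -
  define d where "d n x = (norm (f (Suc n) x - f n x))\<^sup>2" for n x
  have C: "0 \<le> C" using order_trans[OF L2norm_nonneg step[of 0]] by simp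
  have [measurable]: "f m \<in> borel_measurable (lebesgue_on \<Omega>)" for m
    using f by (rule L2_measurable)
  have [measurable]: "d n \<in> borel_measurable (lebesgue_on \<Omega>)" for n
    unfolding d_def by measurable
  \<comment> \<open>A step contributes (C q^n)^2 / q^n = C^2 q^n, so the weighted series has a
    finite integral.\<close>
  have d_le: "(\<integral>\<^sup>+x. ennreal (d n x / q ^ n) \<partial>lebesgue_on \<Omega>) \<le> ennreal (C\<^sup>2 * q ^ n)" for n
  proof -
    have "(\<integral>\<^sup>+x. ennreal (d n x / q ^ n) \<partial>lebesgue_on \<Omega>) =
        (\<integral>\<^sup>+x. ennreal (1 / q ^ n) * ennreal (d n x) \<partial>lebesgue_on \<Omega>)"
      using q by (intro nn_integral_cong) (simp add: ennreal_mult'[symmetric])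
    also have "\<dots> = ennreal (1 / q ^ n) * ennreal ((L2norm \<Omega> (\<lambda>x. f (Suc n) x - f n x))\<^sup>2)"
      using nn_integral_power2_norm[OF L2_diff[OF f f], of "Suc n" n]
      by (subst nn_integral_cmult) (simp_all add: d_def)
    also have "\<dots> = ennreal ((L2norm \<Omega> (\<lambda>x. f (Suc n) x - f n x))\<^sup>2 / q ^ n)"
      using q by (simp add: ennreal_mult'[symmetric])
    also have "\<dots> \<le> ennreal ((C * q ^ n)\<^sup>2 / q ^ n)"
      using step[of n] q by (intro ennreal_leI divide_right_mono power_mono) auto
    also have "(C * q ^ n)\<^sup>2 / q ^ n = C\<^sup>2 * q ^ n"
      using q by (simp add: power2_eq_square field_simps)
    finally show ?thesis .
  qed
  have "(\<integral>\<^sup>+x. (\<Sum>n. ennreal (d n x / q ^ n)) \<partial>lebesgue_on \<Omega>) =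
      (\<Sum>n. \<integral>\<^sup>+x. ennreal (d n x / q ^ n) \<partial>lebesgue_on \<Omega>)"
    by (rule nn_integral_suminf) measurable
  also have "\<dots> \<le> (\<Sum>n. ennreal (C\<^sup>2 * q ^ n))"
    by (intro suminf_le d_le) auto
  also have "\<dots> = ennreal (\<Sum>n. C\<^sup>2 * q ^ n)"
    using q by (intro suminf_ennreal2 summable_mult summable_geometric) auto
  finally have "(\<integral>\<^sup>+x. (\<Sum>n. ennreal (d n x / q ^ n)) \<partial>lebesgue_on \<Omega>) \<noteq> \<infinity>"
    by (auto simp: top_unique)
  then have "AE x in lebesgue_on \<Omega>. (\<Sum>n. ennreal (d n x / q ^ n)) \<noteq> \<infinity>"
    by (intro nn_integral_PInf_AE) measurable
  then show ?thesis
  proof eventually_elim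
    case (elim x)
    have nonneg: "0 \<le> d n x / q ^ n" for n using q by (simp add: d_def)
    have summable: "summable (\<lambda>n. d n x / q ^ n)"
      using elim nonneg by (intro summable_suminf_not_top) auto
    define S where "S = (\<Sum>n. d n x / q ^ n)"
    have "norm (f (Suc n) x - f n x) \<le> sqrt S * sqrt q ^ n" for n
    proof -
      have "d n x / q ^ n = (\<Sum>i\<in>{n}. d i x / q ^ i)" by simp
      also have "\<dots> \<le> S"
        unfolding S_def using nonneg by (intro sum_le_suminf summable) auto
      finally have "d n x \<le> S * q ^ n" using q by (simp add: field_simps)
      then have "sqrt (d n x) \<le> sqrt (S * q ^ n)" by simp
      then show ?thesis by (simp add: d_def real_sqrt_mult real_sqrt_power)
    qed
    moreover have "summable (\<lambda>n. sqrt S * sqrt q ^ n)"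
      using q by (intro summable_mult summable_geometric) simp
    ultimately have "summable (\<lambda>n. f (Suc n) x - f n x)"
      using summable_comparison_test'[of "\<lambda>n. sqrt S * sqrt q ^ n" 0 "\<lambda>n. f (Suc n) x - f n x"] by blast
    then have "convergent (\<lambda>n. f n x - f 0 x)"
      unfolding summable_iff_convergent sum_lessThan_telescope[of "\<lambda>i. f i x"] .
    then have "convergent (\<lambda>n. (f n x - f 0 x) + f 0 x)"
      by (intro convergent_add convergent_const)
    then show ?case by simp
  qed
qed

text \<open>The Riesz-Fischer argument for geometric steps: the bound on f (m + n) - f n is uniform
  in m, and Fatou's lemma passes it to the limit m to infinity.\<close>

lemma L2_geometric_limit:
  fixes f :: "nat \<Rightarrow> real^'n::finite \<Rightarrow> 'b::euclidean_space"
  assumes f: "\<And>n. L2 \<Omega> (f n)" and q: "0 < q" "q < 1" and meas: "\<Omega> \<in> sets lebesgue"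
    and step: "\<And>n. L2norm \<Omega> (\<lambda>x. f (Suc n) x - f n x) \<le> C * q ^ n"
  shows "\<exists>h. L2 \<Omega> h \<and> (\<lambda>n. L2norm \<Omega> (\<lambda>x. h x - f n x)) \<longlonglongrightarrow> 0"
proof (intro exI conjI)
  \<comment> \<open>Where the sequence diverges \<open>lim\<close> is a default value; this happens
    on a null set only, and \<open>?h\<close> is measurable regardless.\<close>
  let ?h = "\<lambda>x. lim (\<lambda>n. f n x)"
  have C: "0 \<le> C" using order_trans[OF L2norm_nonneg step[of 0]] by simp
  have f_meas [measurable]: "f m \<in> borel_measurable (lebesgue_on \<Omega>)" for m
    using f by (rule L2_measurable)
  have h_meas [measurable]: "?h \<in> borel_measurable (lebesgue_on \<Omega>)"
    using f_meas by (rule borel_measurable_lim_metric[where f = f])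
  have lim: "AE x in lebesgue_on \<Omega>. (\<lambda>n. f n x) \<longlonglongrightarrow> ?h x"
    using AE_convergent_if_geometric_L2[OF f q step]
    by eventually_elim (rule iffD1[OF convergent_LIMSEQ_iff])
  \<comment> \<open>The right-hand side is the geometric sum of the steps n, ..., n + m - 1.\<close>
  have tail: "L2norm \<Omega> (\<lambda>x. f (m + n) x - f n x) \<le> C * q ^ n * (1 - q ^ m) / (1 - q)" for m n
  proof (induction m)
    case (Suc m)
    have "L2norm \<Omega> (\<lambda>x. f (Suc m + n) x - f n x) \<le> C * q ^ (m + n) + C * q ^ n * (1 - q ^ m) / (1 - q)"
      using L2norm_triangle[OF f f f meas, of "Suc (m + n)" n "m + n"] step[of "m + n"] Suc by simp
    also have "\<dots> = C * q ^ n * (1 - q ^ Suc m) / (1 - q)"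
      using q by (simp add: field_simps power_add)
    finally show ?case .
  qed simp
  have Fatou: "L2 \<Omega> (\<lambda>x. ?h x - f n x)" "L2norm \<Omega> (\<lambda>x. ?h x - f n x) \<le> C * q ^ n / (1 - q)" for n
  proof -
    have "C * q ^ n * (1 - q ^ m) \<le> C * q ^ n * 1" for m
      using q C by (intro mult_left_mono) auto
    then have "C * q ^ n * (1 - q ^ m) / (1 - q) \<le> C * q ^ n / (1 - q)" for m
      using q by (intro divide_right_mono) auto
    then have le: "L2norm \<Omega> (\<lambda>x. f (m + n) x - f n x) \<le> C * q ^ n / (1 - q)" for m
      by (rule order_trans[OF tail])
    have "AE x in lebesgue_on \<Omega>. (\<lambda>m. f (m + n) x - f n x) \<longlonglongrightarrow> ?h x - f n x"
      using lim
    proof eventually_elim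
      case (elim x)
      from LIMSEQ_ignore_initial_segment[OF this, of n] show ?case
        by (rule tendsto_diff[OF _ tendsto_const])
    qed
    note * = L2_Fatou[where f = "\<lambda>m x. f (m + n) x - f n x", OF L2_diff[OF f f] le _ this]
    show "L2 \<Omega> (\<lambda>x. ?h x - f n x)" "L2norm \<Omega> (\<lambda>x. ?h x - f n x) \<le> C * q ^ n / (1 - q)"
      by (rule *, measurable)+
  qed
  show "L2 \<Omega> ?h" using L2_add[OF Fatou(1)[of 0] f[of 0]] by simp
  have "(\<lambda>n. C * q ^ n / (1 - q)) \<longlonglongrightarrow> C * 0 / (1 - q)"
    using q by (intro tendsto_divide tendsto_mult tendsto_const LIMSEQ_power_zero) auto
  then have "(\<lambda>n. C * q ^ n / (1 - q)) \<longlonglongrightarrow> 0" by simp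
  then show "(\<lambda>n. L2norm \<Omega> (\<lambda>x. ?h x - f n x)) \<longlonglongrightarrow> 0"
  proof (rule Lim_null_comparison[rotated])
    show "\<forall>\<^sub>F n in sequentially. norm (L2norm \<Omega> (\<lambda>x. ?h x - f n x)) \<le> C * q ^ n / (1 - q)"
      unfolding real_norm_def abs_of_nonneg[OF L2norm_nonneg] by (rule always_eventually[OF allI[OF Fatou(2)]])
  qed
qed

text \<open>Banach's theorem for the seminorm \<open>L2norm\<close>, iterating from 0. As
  \<open>L2\<close> is a predicate on functions and not a quotient space, the conclusion can only be
  an a.e. fixed point.\<close>

lemma L2_contraction_fixpoint:
  fixes T :: "(real^'n::finite \<Rightarrow> 'b::euclidean_space) \<Rightarrow> real^'n \<Rightarrow> 'b"
  assumes T: "\<And>f. L2 \<Omega> f \<Longrightarrow> L2 \<Omega> (T f)" and q: "0 < q" "q < 1" and meas: "\<Omega> \<in> sets lebesgue"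
    and contr: "\<And>f g. L2 \<Omega> f \<Longrightarrow> L2 \<Omega> g \<Longrightarrow>
      L2norm \<Omega> (\<lambda>x. T f x - T g x) \<le> q * L2norm \<Omega> (\<lambda>x. f x - g x)"
  obtains f where "L2 \<Omega> f" "AE x in lebesgue_on \<Omega>. T f x = f x"
proof -
  define f where "f n = (T ^^ n) (\<lambda>x. 0)" for n
  have f: "L2 \<Omega> (f n)" for n by (induction n) (auto simp: f_def T)
  have T_f: "T (f n) = f (Suc n)" for n by (simp add: f_def)
  have "L2norm \<Omega> (\<lambda>x. f (Suc n) x - f n x) \<le> L2norm \<Omega> (\<lambda>x. f (Suc 0) x - f 0 x) * q ^ n" for n
  proof (induction n)
    case (Suc n)
    have "L2norm \<Omega> (\<lambda>x. f (Suc (Suc n)) x - f (Suc n) x) \<le> q * L2norm \<Omega> (\<lambda>x. f (Suc n) x - f n x)"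
      using contr[OF f f, of "Suc n" n] unfolding T_f .
    also have "\<dots> \<le> q * (L2norm \<Omega> (\<lambda>x. f (Suc 0) x - f 0 x) * q ^ n)"
      using Suc q by (intro mult_left_mono) auto
    finally show ?case by (simp add: mult_ac)
  qed simp
  then have "\<exists>h. L2 \<Omega> h \<and> (\<lambda>n. L2norm \<Omega> (\<lambda>x. h x - f n x)) \<longlonglongrightarrow> 0"
    by (rule L2_geometric_limit[OF f q meas])
  then obtain h where h: "L2 \<Omega> h" "(\<lambda>n. L2norm \<Omega> (\<lambda>x. h x - f n x)) \<longlonglongrightarrow> 0"
    by blast
  have "L2norm \<Omega> (\<lambda>x. T h x - h x) \<le> q * L2norm \<Omega> (\<lambda>x. h x - f n x) + L2norm \<Omega> (\<lambda>x. h x - f (Suc n) x)" for n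
    using L2norm_triangle[OF T[OF h(1)] f[of "Suc n"] h(1) meas] contr[OF h(1) f[of n]]
      L2norm_minus_commute[of \<Omega> h "f (Suc n)"] unfolding T_f by linarith
  moreover have "(\<lambda>n. q * L2norm \<Omega> (\<lambda>x. h x - f n x) + L2norm \<Omega> (\<lambda>x. h x - f (Suc n) x)) \<longlonglongrightarrow> q * 0 + 0"
    by (intro tendsto_add tendsto_mult tendsto_const h(2) LIMSEQ_Suc[OF h(2)])
  ultimately have "L2norm \<Omega> (\<lambda>x. T h x - h x) \<le> q * 0 + 0"
    by (intro LIMSEQ_le_const) auto
  then have "L2norm \<Omega> (\<lambda>x. T h x - h x) = 0"
    using L2norm_nonneg[of \<Omega> "\<lambda>x. T h x - h x"] by simp
  then have "AE x in lebesgue_on \<Omega>. T h x = h x"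
    using L2norm_eq_0_iff[OF L2_diff[OF T[OF h(1)] h(1)]] by simp
  with h(1) that show thesis by blast
qed

section \<open>Composition with Caratheodory maps\<close>

lemma borel_measurable_vec:
  fixes f :: "'a \<Rightarrow> 'b::euclidean_space^'m::finite"
  assumes "\<And>i. (\<lambda>x. f x $ i) \<in> borel_measurable M"
  shows "f \<in> borel_measurable M"
proof (rule borel_measurable_euclidean_space[THEN iffD2], rule ballI)
  fix b :: "'b^'m" assume "b \<in> Basis"
  then obtain i u where b: "b = axis i u" by (auto simp: Basis_vec_def)
  have "(\<lambda>x. f x $ i \<bullet> u) \<in> borel_measurable M"
    using assms[of i] by measurable
  then show "(\<lambda>x. f x \<bullet> b) \<in> borel_measurable M"
    by (simp add: b inner_axis)
qed

lemma L2_vec: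
  fixes f :: "real^'n::finite \<Rightarrow> 'b::euclidean_space^'m::finite"
  assumes "\<And>i. L2 \<Omega> (\<lambda>x. f x $ i)"
  shows "L2 \<Omega> f"
  unfolding L2_def
proof
  show "f \<in> borel_measurable (lebesgue_on \<Omega>)"
    by (rule borel_measurable_vec[OF L2_measurable[OF assms]])
  have "(norm (f x))\<^sup>2 = (\<Sum>i\<in>UNIV. (norm (f x $ i))\<^sup>2)" for x
    by (simp add: norm_vec_def L2_set_def sum_nonneg)
  then show "integrable (lebesgue_on \<Omega>) (\<lambda>x. (norm (f x))\<^sup>2)"
    using L2_integrable[OF assms] by simp
qed

text \<open>The projection onto symmetric tensors. It repairs simple approximations of a symmetric
  field, whose values may fail to be symmetric.\<close>

definition sym_part :: "real^'n^'n^'N::finite \<Rightarrow> real^'n^'n^'N" where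
  "sym_part X = (\<chi> \<alpha> i j. (X $ \<alpha> $ i $ j + X $ \<alpha> $ j $ i) / 2)"

lemma sym_part_in_sym_tensors: "sym_part X \<in> sym_tensors"
  by (simp add: sym_part_def sym_tensors_def add.commute)

lemma sym_part_eq: "X \<in> sym_tensors \<Longrightarrow> sym_part X = X"
  by (simp add: sym_part_def sym_tensors_def vec_eq_iff)

lemma tendsto_sym_part:
  assumes "(X \<longlongrightarrow> L) A"
  shows "((\<lambda>k. sym_part (X k)) \<longlongrightarrow> sym_part L) A"
  unfolding sym_part_def
  by (intro tendsto_vec_lambda tendsto_divide tendsto_add tendsto_const tendsto_vec_nth assms) simp

text \<open>Approximate H by simple functions, symmetrise them, and pass to the limit through the
  continuity of F(x, .) on symmetric tensors.\<close>

lemma caratheodory_measurable: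
  fixes F :: "real^'n::finite \<Rightarrow> real^'n^'n^'N::finite \<Rightarrow> real^'N"
  assumes car: "caratheodory \<Omega> F" and meas: "\<Omega> \<in> sets lebesgue"
    and H: "H \<in> borel_measurable (lebesgue_on \<Omega>)"
    and sym: "AE x in lebesgue_on \<Omega>. H x \<in> sym_tensors"
  shows "(\<lambda>x. F x (H x)) \<in> borel_measurable (lebesgue_on \<Omega>)"
proof -
  obtain s where s: "\<And>k. simple_function (lebesgue_on \<Omega>) (s k)"
    and s_lim: "\<And>x. x \<in> space (lebesgue_on \<Omega>) \<Longrightarrow> (\<lambda>k. s k x) \<longlonglongrightarrow> H x"
    using borel_measurable_implies_sequence_metric[OF H, of 0] by blast
  define t where "t k x = sym_part (s k x)" for k x
  have F_t: "(\<lambda>x. F x (t k x)) \<in> borel_measurable (lebesgue_on \<Omega>)" for k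
  \<comment> \<open>The approximation takes finitely many values, so measurability of F(., X) for
    each fixed symmetric X is enough.\<close>
  proof (rule measurable_compose_countable'[where f = "\<lambda>X x. F x X" and I = "t k ` \<Omega>"])
    have "simple_function (lebesgue_on \<Omega>) (t k)"
      using simple_function_compose[OF s[of k], of sym_part] by (simp add: t_def[abs_def] comp_def)
    then have fin: "finite (t k ` \<Omega>)"
      and pre: "\<And>X. X \<in> t k ` \<Omega> \<Longrightarrow> t k -` {X} \<inter> \<Omega> \<in> sets (lebesgue_on \<Omega>)"
      unfolding simple_function_def by auto
    show "t k \<in> measurable (lebesgue_on \<Omega>) (count_space (t k ` \<Omega>))"
      using fin pre by (subst measurable_count_space_eq2) auto
    show "countable (t k ` \<Omega>)" using fin by (rule countable_finite)
    fix X assume "X \<in> t k ` \<Omega>"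
    then show "(\<lambda>x. F x X) \<in> borel_measurable (lebesgue_on \<Omega>)"
      using car sym_part_in_sym_tensors by (auto simp: caratheodory_def t_def)
  qed
  have "AE x in lebesgue_on \<Omega>. lim (\<lambda>k. F x (t k x)) = F x (H x)"
  proof -
    have "AE x in lebesgue_on \<Omega>. continuous_on sym_tensors (F x)"
      using car by (simp add: caratheodory_def)
    moreover have "AE x in lebesgue_on \<Omega>. (\<lambda>k. s k x) \<longlonglongrightarrow> H x"
      using s_lim by (rule AE_I2)
    ultimately show ?thesis
      using sym
    proof eventually_elim
      case (elim x)
      have "(\<lambda>k. t k x) \<longlonglongrightarrow> H x"
        using tendsto_sym_part[OF elim(2)] by (simp add: t_def sym_part_eq[OF elim(3)])
      then have "(\<lambda>k. F x (t k x)) \<longlonglongrightarrow> F x (H x)"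
        using elim(1,3)
        by (intro continuous_on_tendsto_compose[of sym_tensors "F x"])
          (auto simp: t_def sym_part_in_sym_tensors)
      then show ?case by (rule limI)
    qed
  qed
  with borel_measurable_lim_metric[where f = "\<lambda>k x. F x (t k x)", OF F_t]
  show ?thesis by (rule borel_measurable_lebesgue_on_AE[OF _ meas])
qed

section \<open>Weak Hessians\<close>

lemma weak_hessian_sym:
  assumes "open \<Omega>" and H: "weak_hessian \<Omega> u H"
  shows "AE x in lebesgue_on \<Omega>. H x \<in> sym_tensors"
proof -
  have "AE x in lebesgue_on \<Omega>. H x $ \<alpha> $ i $ j = H x $ \<alpha> $ j $ i" for \<alpha> i j
    by (rule weak_partial2_symmetric[OF assms(1), of "\<lambda>x. u x $ \<alpha>" i j])
      (use H in \<open>simp_all add: weak_hessian_def\<close>)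
  then have "AE x in lebesgue_on \<Omega>. \<forall>\<alpha> i j. H x $ \<alpha> $ i $ j = H x $ \<alpha> $ j $ i"
    unfolding AE_all_countable by simp
  then show ?thesis by (simp add: sym_tensors_def)
qed

lemma weak_hessian_unique:
  assumes "open \<Omega>" "AE x in lebesgue_on \<Omega>. u x = u' x"
    and H: "weak_hessian \<Omega> u H" and H': "weak_hessian \<Omega> u' H'"
  shows "AE x in lebesgue_on \<Omega>. H x = H' x"
proof -
  have "AE x in lebesgue_on \<Omega>. H x $ \<alpha> $ i $ j = H' x $ \<alpha> $ i $ j" for \<alpha> i j
  proof (rule weak_partial2_unique[OF assms(1), where i = i and j = j])
    show "AE x in lebesgue_on \<Omega>. u x $ \<alpha> = u' x $ \<alpha>"
      using assms(2) by eventually_elim simp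
  qed (use H H' in \<open>simp_all add: weak_hessian_def\<close>)
  then have "AE x in lebesgue_on \<Omega>. \<forall>\<alpha> i j. H x $ \<alpha> $ i $ j = H' x $ \<alpha> $ i $ j"
    unfolding AE_all_countable by simp
  then show ?thesis by (simp add: vec_eq_iff)
qed

text \<open>\<open>H2\<close> provides some square integrable second derivatives, possibly other
  representatives than those in H; uniqueness transfers the property.\<close>

lemma weak_hessian_L2:
  assumes "open \<Omega>" "H2H10 \<Omega> u" and H: "weak_hessian \<Omega> u H"
  shows "L2 \<Omega> H"
proof (intro L2_vec)
  fix \<alpha> i j
  have "H2 \<Omega> (\<lambda>x. u x $ \<alpha>)" using assms(2) by (simp add: H2H10_def)
  then have "\<exists>g. weak_partial2 \<Omega> (\<lambda>x. u x $ \<alpha>) i j g \<and> L2 \<Omega> g" by (simp add: H2_def)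
  then obtain g where g: "weak_partial2 \<Omega> (\<lambda>x. u x $ \<alpha>) i j g" "L2 \<Omega> g"
    by (elim exE conjE)
  have "AE x in lebesgue_on \<Omega>. g x = H x $ \<alpha> $ i $ j"
    by (rule weak_partial2_unique[OF assms(1) _ g(1), where f' = "\<lambda>x. u x $ \<alpha>"]) (use H in \<open>simp_all add: weak_hessian_def\<close>)
  moreover have "\<Omega> \<in> sets lebesgue" using assms(1) by simp
  ultimately show "L2 \<Omega> (\<lambda>x. H x $ \<alpha> $ i $ j)"
    using L2_cong_AE[OF _ g(2)] by simp
qed

section \<open>The zero function as base point of the solution space\<close>

lemma test_fun_zero: "test_fun \<Omega> (\<lambda>x. 0)"
proof -
  have "pd i (\<lambda>x. 0) = (\<lambda>x. 0)" for i :: 'a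
    by (simp add: pd_def fun_eq_iff)
  then have "Ck k (\<lambda>x::real^'a. 0)" for k
    by (induction k) auto
  then show ?thesis by (simp add: test_fun_def smooth_fun_def)
qed

lemma weak_partial_zero: "weak_partial \<Omega> (\<lambda>x. 0) i (\<lambda>x. 0)"
  by (simp add: weak_partial_def loc_int_def)

lemma weak_partial2_zero: "weak_partial2 \<Omega> (\<lambda>x. 0) i j (\<lambda>x. 0)"
  by (simp add: weak_partial2_def loc_int_def)

lemma weak_hessian_zero: "weak_hessian \<Omega> (\<lambda>x. 0) (\<lambda>x. 0)"
  by (simp add: weak_hessian_def weak_partial2_zero)

lemma H1_zero: "H1 \<Omega> (\<lambda>x. 0)"
  unfolding H1_def using weak_partial_zero L2_zero by blast

lemma H2_zero: "H2 \<Omega> (\<lambda>x. 0)"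
  unfolding H2_def using H1_zero weak_partial2_zero L2_zero by blast

text \<open>\<open>H10\<close> quantifies over every weak partial derivative of the zero function,
  so uniqueness must first show that each of them is 0 a.e.\<close>

lemma H10_zero:
  assumes "open \<Omega>"
  shows "H10 \<Omega> (\<lambda>x. 0)"
  unfolding H10_def
proof (intro conjI exI[of _ "\<lambda>k x. 0"] allI impI)
  fix i g assume "weak_partial \<Omega> (\<lambda>x. 0) i g"
  then have "AE x in lebesgue_on \<Omega>. pd i (\<lambda>x. 0) x - g x = 0"
    using weak_partial_unique[OF assms weak_partial_zero]
    by (auto simp: pd_def elim: eventually_mono)
  then have "L2norm \<Omega> (\<lambda>x. pd i (\<lambda>x. 0) x - g x) = L2norm \<Omega> (\<lambda>x. 0 :: real)"
    using assms by (intro L2norm_cong_AE) auto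
  then show "(\<lambda>k. L2norm \<Omega> (\<lambda>x. pd i (\<lambda>x. 0) x - g x)) \<longlonglongrightarrow> 0" by simp
qed (simp_all add: H1_zero test_fun_zero)

lemma H2H10_zero: "open \<Omega> \<Longrightarrow> H2H10 \<Omega> (\<lambda>x. 0)"
  by (simp add: H2H10_def H2_zero H10_zero)

section \<open>Solvability\<close>

text \<open>With u = R f and v = R h, the difference T f - T h is a.e. (F u - F v) - (G u - G v),
  and F u - F v is a.e. f - h, so nearness is exactly contractivity. The index type is abstract
  because the indices will be pairs of a function and a weak Hessian.\<close>

lemma near_operator_surjective:
  fixes F G :: "'h \<Rightarrow> real^'n::finite \<Rightarrow> 'b::euclidean_space"
  assumes F: "\<And>u. u \<in> A \<Longrightarrow> L2 \<Omega> (F u)" and G: "\<And>u. u \<in> A \<Longrightarrow> L2 \<Omega> (G u)"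
    and onto: "\<And>f. L2 \<Omega> f \<Longrightarrow> \<exists>u\<in>A. AE x in lebesgue_on \<Omega>. F u x = f x"
    and near: "\<And>u v. u \<in> A \<Longrightarrow> v \<in> A \<Longrightarrow>
      L2norm \<Omega> (\<lambda>x. (F u x - F v x) - (G u x - G v x)) \<le> q * L2norm \<Omega> (\<lambda>x. F u x - F v x)"
    and q: "0 < q" "q < 1" and meas: "\<Omega> \<in> sets lebesgue" and g: "L2 \<Omega> g"
  shows "\<exists>u\<in>A. AE x in lebesgue_on \<Omega>. G u x = g x"
proof -
  \<comment> \<open>Preimages are chosen separately for each representative f; that R may treat a.e.
    equal functions differently is harmless, as the contraction estimate bounds their
    images.\<close>
  define R where "R f = (SOME u. u \<in> A \<and> (AE x in lebesgue_on \<Omega>. F u x = f x))" for f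
  have R: "R f \<in> A \<and> (AE x in lebesgue_on \<Omega>. F (R f) x = f x)" if "L2 \<Omega> f" for f
    unfolding R_def by (rule someI_ex) (use onto[OF that] in \<open>simp add: Bex_def\<close>)
  note R = R[THEN conjunct1] R[THEN conjunct2]
  define T where "T f x = f x - G (R f) x + g x" for f x
  have "L2norm \<Omega> (\<lambda>x. T f x - T h x) \<le> q * L2norm \<Omega> (\<lambda>x. f x - h x)" if f: "L2 \<Omega> f" and h: "L2 \<Omega> h" for f h
  proof -
    have "L2norm \<Omega> (\<lambda>x. T f x - T h x) =
        L2norm \<Omega> (\<lambda>x. (F (R f) x - F (R h) x) - (G (R f) x - G (R h) x))"
      using R(2)[OF f] R(2)[OF h] by (intro L2norm_cong_AE meas, eventually_elim) (simp add: T_def)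
    also have "\<dots> \<le> q * L2norm \<Omega> (\<lambda>x. F (R f) x - F (R h) x)"
      using R(1) f h by (intro near)
    also have "L2norm \<Omega> (\<lambda>x. F (R f) x - F (R h) x) = L2norm \<Omega> (\<lambda>x. f x - h x)"
      using R(2)[OF f] R(2)[OF h] by (intro L2norm_cong_AE meas, eventually_elim) simp
    finally show ?thesis .
  qed
  moreover have "L2 \<Omega> (T f)" if "L2 \<Omega> f" for f
    unfolding T_def using that R(1) by (intro L2_add L2_diff G g)
  ultimately obtain f where f: "L2 \<Omega> f" "AE x in lebesgue_on \<Omega>. T f x = f x"
    using L2_contraction_fixpoint[OF _ q meas, of T] by blast
  have "AE x in lebesgue_on \<Omega>. G (R f) x = g x"
    using f(2) by eventually_elim (simp add: T_def)
  with R(1)[OF f(1)] show ?thesis by blast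
qed

text \<open>Positivity of \<open>nu\<close> excludes a vanishing denominator for $v \neq w$: the junk quotient
  \<open>x / 0 = 0\<close> would force \<open>nu\<close> to be at most 0.\<close>

lemma nu_mult_le:
  fixes F :: "real^'n::finite \<Rightarrow> real^'n^'n^'N::finite \<Rightarrow> real^'N"
  assumes "open \<Omega>" and pos: "nu \<Omega> F > 0"
    and v: "H2H10 \<Omega> v" "weak_hessian \<Omega> v Hv" and w: "H2H10 \<Omega> w" "weak_hessian \<Omega> w Hw"
  shows "nu \<Omega> F * L2norm \<Omega> (\<lambda>x. Hw x - Hv x) \<le> L2norm \<Omega> (\<lambda>x. F x (Hw x) - F x (Hv x))"
proof (cases "AE x in lebesgue_on \<Omega>. v x = w x")
  case True
  \<comment> \<open>Such pairs are excluded from the infimum, but their Hessians agree a.e. and the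
    left-hand side is 0.\<close>
  have "AE x in lebesgue_on \<Omega>. Hw x - Hv x = 0"
    using weak_hessian_unique[OF assms(1) True v(2) w(2)] by eventually_elim simp
  then have "L2norm \<Omega> (\<lambda>x. Hw x - Hv x) = L2norm \<Omega> (\<lambda>x. 0 :: real^'n^'n^'N)"
    using assms(1) by (intro L2norm_cong_AE) auto
  then show ?thesis by simp
next
  case False
  let ?r = "L2norm \<Omega> (\<lambda>x. F x (Hw x) - F x (Hv x)) / L2norm \<Omega> (\<lambda>x. Hw x - Hv x)"
  have le: "nu \<Omega> F \<le> ?r"
    unfolding nu_def
  proof (rule cInf_lower)
    show "?r \<in> {L2norm \<Omega> (\<lambda>x. F x (Hw x) - F x (Hv x)) / L2norm \<Omega> (\<lambda>x. Hw x - Hv x) |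
        v w Hv Hw. H2H10 \<Omega> v \<and> H2H10 \<Omega> w \<and> weak_hessian \<Omega> v Hv \<and> weak_hessian \<Omega> w Hw \<and>
          \<not> (AE x in lebesgue_on \<Omega>. v x = w x)}"
      using v w False by blast
  qed (auto intro!: bdd_belowI[of _ 0])
  with pos have "L2norm \<Omega> (\<lambda>x. Hw x - Hv x) \<noteq> 0" by auto
  then have "L2norm \<Omega> (\<lambda>x. Hw x - Hv x) > 0"
    using L2norm_nonneg[of \<Omega> "\<lambda>x. Hw x - Hv x"] by linarith
  with le show ?thesis by (simp add: field_simps)
qed

lemma esssup_difference_quotient:
  fixes D :: "'a \<Rightarrow> 'b::real_normed_vector \<Rightarrow> 'b \<Rightarrow> 'c::real_normed_vector"
  assumes "esssup M (\<lambda>x. SUP XY \<in> {(X, Y). X \<in> S \<and> Y \<in> S \<and> X \<noteq> Y}.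
      ereal (norm (D x (fst XY) (snd XY)) / norm (snd XY - fst XY))) < ereal c"
    and "c > 0"
  obtains k where "0 < k" "k < c"
    "AE x in M. \<forall>X\<in>S. \<forall>Y\<in>S. X \<noteq> Y \<longrightarrow> norm (D x X Y) \<le> k * norm (Y - X)"
proof -
  let ?\<phi> = "\<lambda>x. SUP XY \<in> {(X, Y). X \<in> S \<and> Y \<in> S \<and> X \<noteq> Y}.
      ereal (norm (D x (fst XY) (snd XY)) / norm (snd XY - fst XY))"
  \<comment> \<open>The strict inequality leaves room for a real k. The maximum with 0 forces k > 0,
    hence a positive contraction constant, even if the essential supremum is not positive.\<close>
  have "max 0 (esssup M ?\<phi>) < ereal c" using assms by simp
  then obtain k where k: "max 0 (esssup M ?\<phi>) < ereal k" "ereal k < ereal c"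
    by (rule ereal_dense2[THEN exE]) blast
  have "AE x in M. \<forall>X\<in>S. \<forall>Y\<in>S. X \<noteq> Y \<longrightarrow> norm (D x X Y) \<le> k * norm (Y - X)"
    using esssup_AE[of ?\<phi> M]
  proof eventually_elim
    case (elim x)
    show ?case
    proof (intro ballI impI)
      fix X Y assume XY: "X \<in> S" "Y \<in> S" "X \<noteq> Y"
      have "ereal (norm (D x (fst (X, Y)) (snd (X, Y))) / norm (snd (X, Y) - fst (X, Y))) \<le> ?\<phi> x"
        using XY by (intro SUP_upper) auto
      also have "\<dots> \<le> ereal k"
        by (rule order_trans[OF elim]) (use k(1) in \<open>simp add: less_imp_le\<close>)
      finally show "norm (D x X Y) \<le> k * norm (Y - X)"
        using XY(3) by (simp add: pos_divide_le_eq)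
    qed
  qed
  with k that[of k] show thesis by simp
qed

theorem theorem11:
  fixes \<Omega> :: "(real^'n::finite) set"
    and F G :: "real^'n \<Rightarrow> real^'n^'n^'N::finite \<Rightarrow> real^'N"
  assumes "CARD('n) \<ge> 2" and "CARD('N) \<ge> 2"
    and "bounded \<Omega>" and "open \<Omega>"
    and "caratheodory \<Omega> F" and "caratheodory \<Omega> G"
    and F_into: "\<forall>u H. H2H10 \<Omega> u \<and> weak_hessian \<Omega> u H \<longrightarrow> L2 \<Omega> (\<lambda>x. F x (H x))"
    and F_onto: "\<forall>g. L2 \<Omega> g \<longrightarrow> (\<exists>u H. H2H10 \<Omega> u \<and> weak_hessian \<Omega> u H \<and>
                    (AE x in lebesgue_on \<Omega>. F x (H x) = g x))"
    and F_inj: "\<forall>u v Hu Hv. H2H10 \<Omega> u \<and> H2H10 \<Omega> v \<and> weak_hessian \<Omega> u Hu \<and> weak_hessian \<Omega> v Hv \<and>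
                    (AE x in lebesgue_on \<Omega>. F x (Hu x) = F x (Hv x))
                    \<longrightarrow> (AE x in lebesgue_on \<Omega>. u x = v x)"
    and "L2 \<Omega> (\<lambda>x. G x 0)"
    and "nu \<Omega> F > 0"
    and "esssup (lebesgue_on \<Omega>)
           (\<lambda>x. SUP XY \<in> {(X, Y). X \<in> sym_tensors \<and> Y \<in> sym_tensors \<and> X \<noteq> Y}.
                  ereal (norm ((F x (snd XY) - F x (fst XY)) - (G x (snd XY) - G x (fst XY)))
                         / norm (snd XY - fst XY)))
         < ereal (nu \<Omega> F)"
    and "L2 \<Omega> g"
  shows "\<exists>u. H2H10 \<Omega> u \<and> (\<exists>H. weak_hessian \<Omega> u H \<and> (AE x in lebesgue_on \<Omega>. G x (H x) = g x)) \<and>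
           (\<forall>v Hv. H2H10 \<Omega> v \<and> weak_hessian \<Omega> v Hv \<and> (AE x in lebesgue_on \<Omega>. G x (Hv x) = g x)
              \<longrightarrow> (AE x in lebesgue_on \<Omega>. v x = u x))"
proof -
  note op = \<open>open \<Omega>\<close>
  have meas: "\<Omega> \<in> sets lebesgue" using op by simp
  \<comment> \<open>Pairs are used because a weak Hessian is related to u without being a function
    of it.\<close>
  define A :: "((real^'n \<Rightarrow> real^'N) \<times> (real^'n \<Rightarrow> real^'n^'n^'N)) set"
    where "A = {(u, H). H2H10 \<Omega> u \<and> weak_hessian \<Omega> u H}"
  have A: "H2H10 \<Omega> u" "weak_hessian \<Omega> u H" if "(u, H) \<in> A" for u H
    using that by (auto simp: A_def)
  have zero_A: "((\<lambda>x. 0), (\<lambda>x. 0)) \<in> A"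
    using op by (simp add: A_def H2H10_zero weak_hessian_zero)
  obtain k where k: "0 < k" "k < nu \<Omega> F"
    and lip': "AE x in lebesgue_on \<Omega>. \<forall>X\<in>sym_tensors. \<forall>Y\<in>sym_tensors. X \<noteq> Y \<longrightarrow>
        norm ((F x Y - F x X) - (G x Y - G x X)) \<le> k * norm (Y - X)"
    using esssup_difference_quotient[OF assms(12) assms(11)] by blast
  have lip: "AE x in lebesgue_on \<Omega>. \<forall>X\<in>sym_tensors. \<forall>Y\<in>sym_tensors.
        norm ((F x Y - F x X) - (G x Y - G x X)) \<le> k * norm (Y - X)"
    using lip'
  proof eventually_elim
    case (elim x)
    show ?case
    proof (intro ballI)
      fix X Y :: "real^'n^'n^'N"
      assume "X \<in> sym_tensors" "Y \<in> sym_tensors"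
      with elim show "norm ((F x Y - F x X) - (G x Y - G x X)) \<le> k * norm (Y - X)"
        by (cases "X = Y") auto
    qed
  qed
  define q where "q = k / nu \<Omega> F"
  have q: "0 < q" "q < 1" using k by (simp_all add: q_def)
  have near_AE: "AE x in lebesgue_on \<Omega>.
      norm ((F x (H x) - F x (K x)) - (G x (H x) - G x (K x))) \<le> k * norm (H x - K x)"
    if "(u, H) \<in> A" "(v, K) \<in> A" for u v H K
    using lip weak_hessian_sym[OF op A(2)[OF that(2)]] weak_hessian_sym[OF op A(2)[OF that(1)]]
  proof eventually_elim
    case (elim x)
    from bspec[OF elim(1) elim(2)] show ?case by (rule bspec) (rule elim(3))
  qed
  have H_L2: "L2 \<Omega> H" if "(u, H) \<in> A" for u H
    using weak_hessian_L2[OF op] A[OF that] by blast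
  have F_L2: "L2 \<Omega> (\<lambda>x. F x (H x))" if "(u, H) \<in> A" for u H
    using F_into A[OF that] by blast
  have G_L2: "L2 \<Omega> (\<lambda>x. G x (H x))" if uH: "(u, H) \<in> A" for u H
  proof -
    \<comment> \<open>G(x, H) equals F(x, H) - F(x, 0) - d(x) + G(x, 0), where |d| <= k |H| by
      comparison with the zero function; every term on the right is in L^2.\<close>
    let ?d = "\<lambda>x. (F x (H x) - F x 0) - (G x (H x) - G x 0)"
    have G_meas: "(\<lambda>x. G x (H x)) \<in> borel_measurable (lebesgue_on \<Omega>)"
      by (rule caratheodory_measurable[OF \<open>caratheodory \<Omega> G\<close> meas L2_measurable[OF H_L2[OF uH]]
            weak_hessian_sym[OF op A(2)[OF uH]]])
    have "L2 \<Omega> ?d"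
    proof (rule L2_bound[OF _ L2_scaleR[OF H_L2[OF uH], of k]])
      show "?d \<in> borel_measurable (lebesgue_on \<Omega>)"
        by (intro borel_measurable_diff G_meas L2_measurable[OF F_L2[OF uH]]
            L2_measurable[OF F_L2[OF zero_A]] L2_measurable[OF assms(10)])
      show "AE x in lebesgue_on \<Omega>. norm (?d x) \<le> norm (k *\<^sub>R H x)"
        using near_AE[OF uH zero_A] by eventually_elim (use k in simp)
    qed
    from L2_add[OF L2_diff[OF L2_diff[OF F_L2[OF uH] F_L2[OF zero_A]] this] assms(10)]
    show ?thesis by simp
  qed
  have near: "L2norm \<Omega> (\<lambda>x. (F x (H x) - F x (K x)) - (G x (H x) - G x (K x)))
      \<le> q * L2norm \<Omega> (\<lambda>x. F x (H x) - F x (K x))"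
    if uH: "(u, H) \<in> A" and vK: "(v, K) \<in> A" for u v H K
  proof -
    have "L2norm \<Omega> (\<lambda>x. (F x (H x) - F x (K x)) - (G x (H x) - G x (K x)))
        \<le> k * L2norm \<Omega> (\<lambda>x. H x - K x)"
      by (rule L2norm_mono[OF L2_diff[OF L2_diff[OF F_L2[OF uH] F_L2[OF vK]]
            L2_diff[OF G_L2[OF uH] G_L2[OF vK]]] L2_diff[OF H_L2[OF uH] H_L2[OF vK]]
            less_imp_le[OF k(1)] near_AE[OF uH vK]])
    also have "\<dots> = q * (nu \<Omega> F * L2norm \<Omega> (\<lambda>x. H x - K x))"
      using k by (simp add: q_def)
    also have "\<dots> \<le> q * L2norm \<Omega> (\<lambda>x. F x (H x) - F x (K x))"
      using q by (intro mult_left_mono nu_mult_le[OF op assms(11) A[OF vK] A[OF uH]]) auto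
    finally show ?thesis .
  qed
  have "\<exists>p\<in>A. AE x in lebesgue_on \<Omega>. G x (snd p x) = g x"
  proof (rule near_operator_surjective[where F = "\<lambda>p x. F x (snd p x)" and G = "\<lambda>p x. G x (snd p x)"])
    show "L2 \<Omega> (\<lambda>x. F x (snd p x))" "L2 \<Omega> (\<lambda>x. G x (snd p x))" if "p \<in> A" for p
      using that F_L2[of "fst p" "snd p"] G_L2[of "fst p" "snd p"] by simp_all
    show "\<exists>p\<in>A. AE x in lebesgue_on \<Omega>. F x (snd p x) = f x" if f: "L2 \<Omega> f" for f
    proof -
      obtain u H where "H2H10 \<Omega> u" "weak_hessian \<Omega> u H" "AE x in lebesgue_on \<Omega>. F x (H x) = f x"
        using F_onto[THEN spec, THEN mp, OF f] by (elim exE conjE)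
      then show ?thesis by (intro bexI[of _ "(u, H)"]) (simp_all add: A_def)
    qed
    show "L2norm \<Omega> (\<lambda>x. (F x (snd p x) - F x (snd p' x)) - (G x (snd p x) - G x (snd p' x)))
        \<le> q * L2norm \<Omega> (\<lambda>x. F x (snd p x) - F x (snd p' x))" if "p \<in> A" "p' \<in> A" for p p'
      using near[of "fst p" "snd p" "fst p'" "snd p'"] that by simp
  qed (fact q(1), fact q(2), fact meas, fact \<open>L2 \<Omega> g\<close>)
  then obtain p where p: "p \<in> A" "AE x in lebesgue_on \<Omega>. G x (snd p x) = g x" ..
  obtain u H where "p = (u, H)" by (cases p)
  with p have uH: "(u, H) \<in> A" and sol: "AE x in lebesgue_on \<Omega>. G x (H x) = g x" by simp_all
  have "AE x in lebesgue_on \<Omega>. v x = u x"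
    if v: "H2H10 \<Omega> v" "weak_hessian \<Omega> v K" and sol': "AE x in lebesgue_on \<Omega>. G x (K x) = g x" for v K
  proof -
    have vK: "(v, K) \<in> A" using v by (simp add: A_def)
    let ?N = "L2norm \<Omega> (\<lambda>x. F x (K x) - F x (H x))"
    \<comment> \<open>Both Hessians solve the equation for G, so the G-difference vanishes a.e. and
      nearness reads N <= q N, which forces N = 0 since q < 1. Injectivity of F then identifies v
      and u.\<close>
    have "?N = L2norm \<Omega> (\<lambda>x. (F x (K x) - F x (H x)) - (G x (K x) - G x (H x)))"
      using sol sol' by (intro L2norm_cong_AE meas, eventually_elim) simp
    then have "?N \<le> q * ?N" using near[OF vK uH] by simp
    then have "?N * (1 - q) \<le> 0" by (simp add: algebra_simps)
    then have "?N = 0"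
      using q L2norm_nonneg[of \<Omega> "\<lambda>x. F x (K x) - F x (H x)"] by (simp add: mult_le_0_iff)
    then have "AE x in lebesgue_on \<Omega>. F x (K x) = F x (H x)"
      using L2norm_eq_0_iff[OF L2_diff[OF F_L2[OF vK] F_L2[OF uH]]] by simp
    then have "H2H10 \<Omega> v \<and> H2H10 \<Omega> u \<and> weak_hessian \<Omega> v K \<and> weak_hessian \<Omega> u H \<and>
        (AE x in lebesgue_on \<Omega>. F x (K x) = F x (H x))"
      by (intro conjI v A[OF uH])
    then show ?thesis by (rule F_inj[THEN spec, THEN spec, THEN spec, THEN spec, THEN mp])
  qed
  then have "\<forall>v Hv. H2H10 \<Omega> v \<and> weak_hessian \<Omega> v Hv \<and> (AE x in lebesgue_on \<Omega>. G x (Hv x) = g x)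
      \<longrightarrow> (AE x in lebesgue_on \<Omega>. v x = u x)"
    by (intro allI impI) (elim conjE)
  moreover have "\<exists>H. weak_hessian \<Omega> u H \<and> (AE x in lebesgue_on \<Omega>. G x (H x) = g x)"
    by (rule exI[of _ H]) (rule conjI[OF A(2)[OF uH] sol])
  ultimately show ?thesis
    by (intro exI[of _ u] conjI A(1)[OF uH])
qed

end
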